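(* Let $F$ be a field of characteristic $2$, let $b_{ij}\in F$ ($1\le i<j\le 6$) be generic, put $\omega_{ijk}=b_{ij}+b_{ik}+b_{jk}$ for $i<j<k$, and let permitted colorings of the simplices of the 5-simplex $\Delta^5=123456$ be defined by the "infinitesimal" edge functionals built from $\omega$. Consider the symmetric bilinear 4-cochain $\zeta$ on $\Delta^5$ whose component on the pentachoron $12345$ is $$\begin{aligned} \zeta_{12345}={}&\frac{\omega_{123}\omega_{124}(\omega_{125}+\omega_{123})(\omega_{125}+\omega_{124})\,\Omega}{(\omega_{124}+\omega_{123})(\omega_{134}\omega_{235}+\omega_{135}\omega_{234})}\,(x_{1245}x'_{1235}+x_{1235}x'_{1245})\\ &+\frac{\omega_{123}(\omega_{125}+\omega_{123})(\omega_{125}+\omega_{124})\omega_{134}\omega_{135}(\omega_{135}+\omega_{134})}{\omega_{134}\omega_{235}+\omega_{135}\omega_{234}}\,(x_{1345}x'_{1235}+x_{1235}x'_{1345})\\ &+\frac{\omega_{123}^2(\omega_{125}+\omega_{123})(\omega_{125}+\omega_{124})\,\Omega}{(\omega_{124}+\omega_{123})(\omega_{134}\omega_{235}+\omega_{135}\omega_{234})}\,x_{1235}x'_{1235}\\ &+\frac{\omega_{124}(\omega_{125}+\omega_{123})(\omega_{125}+\omega_{124})\omega_{134}\omega_{135}(\omega_{135}+\omega_{134})}{\omega_{134}\omega_{235}+\omega_{135}\omega_{234}}\,(x_{1345}x'_{1245}+x_{1245}x'_{1345})\\ &+\frac{\omega_{124}^2(\omega_{125}+\omega_{123})(\omega_{125}+\omega_{124})\,\Omega}{(\omega_{124}+\omega_{123})(\omega_{134}\omega_{235}+\omega_{135}\omega_{234})}\,x_{1245}x'_{1245}\\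 &+\frac{(\omega_{125}+\omega_{124})\omega_{134}^2\omega_{135}^2(\omega_{135}+\omega_{134})}{\omega_{134}\omega_{235}+\omega_{135}\omega_{234}}\,x_{1345}x'_{1345}\\ &+\frac{\omega_{234}\omega_{235}(\omega_{235}+\omega_{234})(\Omega+\omega_{125}\omega_{134}\omega_{135}+\omega_{124}\omega_{134}\omega_{135})}{\omega_{134}\omega_{235}+\omega_{135}\omega_{234}}\,x_{2345}x'_{2345}\\ &+\omega_{123}\omega_{234}\omega_{235}(\omega_{245}+\omega_{345})\,x_{2345}x'_{2345}\\ &+(\omega_{245}+\omega_{145})(\omega_{245}+\omega_{345})\omega_{245}\omega_{345}\,y_{2345}y'_{2345}, \end{aligned}$$ where $$\Omega=\omega_{124}\omega_{125}\omega_{135}+\omega_{123}\omega_{125}\omega_{135}+\omega_{124}\omega_{125}\omega_{134}+\omega_{123}\omega_{124}\omega_{134},$$ and whose component on any pentachoron $ijklm$, $i<j<k<l<m$, is obtained by the substitution $1\mapsto i$, $2\mapsto j$, $3\mapsto k$, $4\mapsto l$, $5\mapsto m$. Then $\zeta$ is a nontrivial symmetric bilinear 4-cocycle on $\Delta^5$: for any two permitted colorings of $\Delta^5$, $$\zeta_{12345}+\zeta_{12346}+\zeta_{12356}+\zeta_{12456}+\zeta_{13456}+\zeta_{23456}=0,$$ and $\zeta$ is not the coboundary of any symmetric bilinear 3-cochain.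
   Context: A pentachoron is a 4-simplex and a tetrahedron is a 3-simplex; simplices are written with vertices in increasing order. $F$ is assumed big enough to contain generic elements; "generic" means that the $b_{ij}$ lie outside the zero set of some suitable nonzero polynomial (they satisfy no accidental algebraic relation; in particular the denominators above do not vanish). A coloring assigns to each tetrahedron $t$ a column $(x_t,y_t)^{\mathrm T}\in F^2$; $(x_t,y_t)$ and $(x'_t,y'_t)$ denote the components of the two permitted colorings on which a bilinear form is evaluated. Infinitesimal edge functionals (in characteristic 2, where signs are irrelevant): for a tetrahedron $t=1234$ set $$r(12)=(\omega_{234}+\omega_{134},\,0),\quad r(13)=(\omega_{124},\,\omega_{234}),\quad r(14)=(\omega_{123},\,\omega_{234}),$$ $$r(23)=(\omega_{124},\,\omega_{134}),\quad r(24)=(\omega_{123},\,\omega_{134}),\quad r(34)=(0,\,\omega_{123}+\omega_{124}),$$ and for $t=ijkl$, $i<j<k<l$, define the rows $r_t(e)$ ($e$ an edge of $t$) by substituting $1\mapsto i$, $2\mapsto j$, $3\mapsto k$, $4\mapsto l$. For a pentachoron $u$ and an edge $e\subset u$, the edge functional is $\phi^{(u)}_{e}=\sum_{t:\ e\subset t\subset u}r_t(e)\,(x_t,y_t)^{\mathrm T}$. A coloring of $u$ is permitted if $\phi_e^{(u)}=0$ for all ten edges $e\subset u$. All colorings of a tetrahedron are permitted; a coloring of $\Delta^5$ is permitted if its restrictions to all six pentachora are permitted. Cohomology: for $n\ge3$, a symmetric bilinear $n$-cochain $\mathfrak c$ assigns to each $n$-simplex $i_0\dots i_n$ of $\Delta^5$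 a symmetric bilinear form $\mathfrak c_{i_0\dots i_n}$ with values in $F$ on the vector space of permitted colorings of that simplex. The coboundary (in characteristic 2) is $(\delta\mathfrak c)_{i_0\dots i_{n+1}}=\sum_{m=0}^{n+1}\mathfrak c_{i_0\dots\widehat{i_m}\dots i_{n+1}}$, where each term is evaluated on the restrictions of the permitted colorings to the corresponding face. *)

theory Defs
  imports
    "HOL-Library.Poly_Mapping"
    "HOL-Library.Function_Algebras"
    "HOL-Library.Product_Plus"
    "HOL-Computational_Algebra.Computational_Algebra"
begin

text \<open>
  Polynomials over the field in the indeterminates \<open>b\<^sub>i\<^sub>j\<close>: finitely supported maps from
  exponent vectors to coefficients. Genericity of the \<open>b\<^sub>i\<^sub>j\<close> is non-vanishing of some
  nonzero polynomial of this kind.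
\<close>

type_synonym 'a edge_poly = "((nat \<times> nat) \<Rightarrow>\<^sub>0 nat) \<Rightarrow>\<^sub>0 'a"

definition edge_polys :: "'a::field edge_poly set" where
  "edge_polys = {P. \<forall>m \<in> Poly_Mapping.keys P.
     Poly_Mapping.keys m \<subseteq> {(i, j). 1 \<le> i \<and> i < j \<and> j \<le> 6}}"

definition eval_edge_poly :: "'a::field edge_poly \<Rightarrow> (nat \<Rightarrow> nat \<Rightarrow> 'a) \<Rightarrow> 'a" where
  "eval_edge_poly P b =
     (\<Sum>m\<in>Poly_Mapping.keys P. Poly_Mapping.lookup P m *
        (\<Prod>(i, j)\<in>Poly_Mapping.keys m. b i j ^ Poly_Mapping.lookup m (i, j)))"

text \<open>
  A simplex is represented by its set of vertices; the increasing order of the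
  vertices is recovered with \<open>sorted_list_of_set\<close>.
\<close>

definition simplices :: "nat \<Rightarrow> nat set set" where
  "simplices n = {s. s \<subseteq> {1..6} \<and> card s = n + 1}"

definition faces :: "nat \<Rightarrow> nat set \<Rightarrow> nat set set" where
  "faces n s = {t. t \<subseteq> s \<and> card t = n + 1}"

definition omega :: "(nat \<Rightarrow> nat \<Rightarrow> 'a::field) \<Rightarrow> nat \<Rightarrow> nat \<Rightarrow> nat \<Rightarrow> 'a" where
  "omega b i j k = b i j + b i k + b j k"

text \<open>
  A coloring sends a tetrahedron \<open>t\<close> to \<open>(x\<^sub>t, y\<^sub>t)\<close>. A coloring of a simplex \<open>s\<close> is
  normalized to be \<open>0\<close> on everything that is not a tetrahedron of \<open>s\<close>, so that
  equality of functions is equality of colorings.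
\<close>

type_synonym 'a coloring = "nat set \<Rightarrow> 'a \<times> 'a"

definition colorings :: "nat set \<Rightarrow> 'a::field coloring set" where
  "colorings s = {p. \<forall>t. t \<notin> faces 3 s \<longrightarrow> p t = 0}"

definition restr :: "nat set \<Rightarrow> 'a::field coloring \<Rightarrow> 'a coloring" where
  "restr s p = (\<lambda>t. if t \<in> faces 3 s then p t else 0)"

definition scale_col :: "'a::field \<Rightarrow> 'a coloring \<Rightarrow> 'a coloring" where
  "scale_col c p = (\<lambda>t. (c * fst (p t), c * snd (p t)))"

definition edge_row ::
    "(nat \<Rightarrow> nat \<Rightarrow> nat \<Rightarrow> 'a::field) \<Rightarrow> nat set \<Rightarrow> nat set \<Rightarrow> 'a \<times> 'a" where
  "edge_row w t e = (case sorted_list_of_set t of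
     [i, j, k, l] \<Rightarrow>
       (if e = {i, j} then (w j k l + w i k l, 0)
        else if e = {i, k} then (w i j l, w j k l)
        else if e = {i, l} then (w i j k, w j k l)
        else if e = {j, k} then (w i j l, w i k l)
        else if e = {j, l} then (w i j k, w i k l)
        else if e = {k, l} then (0, w i j k + w i j l)
        else 0)
   | _ \<Rightarrow> 0)"

definition edge_functional ::
    "(nat \<Rightarrow> nat \<Rightarrow> nat \<Rightarrow> 'a::field) \<Rightarrow> nat set \<Rightarrow> nat set \<Rightarrow> 'a coloring \<Rightarrow> 'a" where
  "edge_functional w u e p =
     (\<Sum>t \<in> {t \<in> faces 3 u. e \<subseteq> t}.
        fst (edge_row w t e) * fst (p t) + snd (edge_row w t e) * snd (p t))"

text \<open>
  For a tetrahedron the condition is void, for a pentachoron the only \<open>u\<close> is the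
  pentachoron itself, and for the 5-simplex \<open>u\<close> ranges over its six pentachora.
\<close>

definition permitted ::
    "(nat \<Rightarrow> nat \<Rightarrow> nat \<Rightarrow> 'a::field) \<Rightarrow> nat set \<Rightarrow> 'a coloring set" where
  "permitted w s = {p \<in> colorings s.
     \<forall>u \<in> faces 4 s. \<forall>e \<in> faces 1 u. edge_functional w u e (restr u p) = 0}"

type_synonym 'a cochain = "nat set \<Rightarrow> 'a coloring \<Rightarrow> 'a coloring \<Rightarrow> 'a"

definition sym_bilinear_on ::
    "'a::field coloring set \<Rightarrow> ('a coloring \<Rightarrow> 'a coloring \<Rightarrow> 'a) \<Rightarrow> bool" where
  "sym_bilinear_on V B \<longleftrightarrow>
     (\<forall>p\<in>V. \<forall>q\<in>V. B p q = B q p) \<and>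
     (\<forall>p\<in>V. \<forall>q\<in>V. \<forall>r\<in>V. B (p + q) r = B p r + B q r) \<and>
     (\<forall>c. \<forall>p\<in>V. \<forall>q\<in>V. B (scale_col c p) q = c * B p q)"

definition sym_bilinear_cochain ::
    "(nat \<Rightarrow> nat \<Rightarrow> nat \<Rightarrow> 'a::field) \<Rightarrow> nat \<Rightarrow> 'a cochain \<Rightarrow> bool" where
  "sym_bilinear_cochain w n c \<longleftrightarrow>
     (\<forall>s \<in> simplices n. sym_bilinear_on (permitted w s) (c s))"

text \<open>The coboundary in characteristic 2 (no signs).\<close>

definition coboundary :: "'a::field cochain \<Rightarrow> 'a cochain" where
  "coboundary c s p q =
     (\<Sum>v\<in>s. c (s - {v}) (restr (s - {v}) p) (restr (s - {v}) q))"

definition cochain_eq ::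
    "(nat \<Rightarrow> nat \<Rightarrow> nat \<Rightarrow> 'a::field) \<Rightarrow> nat \<Rightarrow> 'a cochain \<Rightarrow> 'a cochain \<Rightarrow> bool" where
  "cochain_eq w n c d \<longleftrightarrow>
     (\<forall>s \<in> simplices n. \<forall>p \<in> permitted w s. \<forall>q \<in> permitted w s. c s p q = d s p q)"

definition Omega :: "(nat \<Rightarrow> nat \<Rightarrow> nat \<Rightarrow> 'a::field) \<Rightarrow> nat \<Rightarrow> nat \<Rightarrow> nat \<Rightarrow> nat \<Rightarrow> nat \<Rightarrow> 'a" where
  "Omega w i j k l m =
     w i j l * w i j m * w i k m + w i j k * w i j m * w i k m
     + w i j l * w i j m * w i k l + w i j k * w i j l * w i k l"

definition zeta_form ::
    "(nat \<Rightarrow> nat \<Rightarrow> nat \<Rightarrow> 'a::field) \<Rightarrow> nat \<Rightarrow> nat \<Rightarrow> nat \<Rightarrow> nat \<Rightarrow> nat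
       \<Rightarrow> 'a coloring \<Rightarrow> 'a coloring \<Rightarrow> 'a" where
  "zeta_form w i j k l m p q =
    (let w123 = w i j k; w124 = w i j l; w125 = w i j m; w134 = w i k l; w135 = w i k m;
         w145 = w i l m; w234 = w j k l; w235 = w j k m; w245 = w j l m; w345 = w k l m;
         Om = Omega w i j k l m;
         x1235 = fst (p {i, j, k, m}); x1235' = fst (q {i, j, k, m});
         x1245 = fst (p {i, j, l, m}); x1245' = fst (q {i, j, l, m});
         x1345 = fst (p {i, k, l, m}); x1345' = fst (q {i, k, l, m});
         x2345 = fst (p {j, k, l, m}); x2345' = fst (q {j, k, l, m});
         y2345 = snd (p {j, k, l, m}); y2345' = snd (q {j, k, l, m})
     in
       w123 * w124 * (w125 + w123) * (w125 + w124) * Om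
         / ((w124 + w123) * (w134 * w235 + w135 * w234))
         * (x1245 * x1235' + x1235 * x1245')
     + w123 * (w125 + w123) * (w125 + w124) * w134 * w135 * (w135 + w134)
         / (w134 * w235 + w135 * w234)
         * (x1345 * x1235' + x1235 * x1345')
     + w123^2 * (w125 + w123) * (w125 + w124) * Om
         / ((w124 + w123) * (w134 * w235 + w135 * w234))
         * (x1235 * x1235')
     + w124 * (w125 + w123) * (w125 + w124) * w134 * w135 * (w135 + w134)
         / (w134 * w235 + w135 * w234)
         * (x1345 * x1245' + x1245 * x1345')
     + w124^2 * (w125 + w123) * (w125 + w124) * Om
         / ((w124 + w123) * (w134 * w235 + w135 * w234))
         * (x1245 * x1245')
     + (w125 + w124) * w134^2 * w135^2 * (w135 + w134)
         / (w134 * w235 + w135 * w234)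
         * (x1345 * x1345')
     + w234 * w235 * (w235 + w234) * (Om + w125 * w134 * w135 + w124 * w134 * w135)
         / (w134 * w235 + w135 * w234)
         * (x2345 * x2345')
     + w123 * w234 * w235 * (w245 + w345) * (x2345 * x2345')
     + (w245 + w145) * (w245 + w345) * w245 * w345 * (y2345 * y2345'))"

definition zeta :: "(nat \<Rightarrow> nat \<Rightarrow> nat \<Rightarrow> 'a::field) \<Rightarrow> 'a cochain" where
  "zeta w s p q = (case sorted_list_of_set s of
     [i, j, k, l, m] \<Rightarrow> zeta_form w i j k l m p q
   | _ \<Rightarrow> 0)"

text \<open>
  Division by zero is total in HOL, so the non-vanishing of the denominators of \<open>\<zeta>\<close>
  has to be stated separately.
\<close>

definition zeta_denominators_nonzero :: "(nat \<Rightarrow> nat \<Rightarrow> nat \<Rightarrow> 'a::field) \<Rightarrow> bool" where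
  "zeta_denominators_nonzero w \<longleftrightarrow>
     (\<forall>i j k l m. 1 \<le> i \<and> i < j \<and> j < k \<and> k < l \<and> l < m \<and> m \<le> 6 \<longrightarrow>
        w i j l + w i j k \<noteq> 0 \<and> w i k l * w j k m + w i k m * w j k l \<noteq> 0)"

end

theory Submission
  imports Defs "HOL-Library.Product_Lexorder"
begin

text \<open>
  Why the theorem holds. On the 5-simplex every permitted coloring comes from a potential \<open>u\<close> on the
  triangles with \<open>\<Sum> \<omega>\<^sub>f u\<^sub>f = 0\<close> on every tetrahedron: the value of an edge functional on one
  tetrahedron is the difference of \<open>u\<close> on the two triangles at that edge, and being permitted says
  that these differences close up around each edge (\<open>permitted_lift\<close>). Hence colorings are given by
  2-cocycles \<open>z = \<omega> u\<close>, that is, by first-order deformations of \<open>\<omega>\<close>, and \<open>z = \<omega>\<close> gives the zero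
  coloring.

  In terms of cocycles the formula for \<open>\<zeta>\<close> collapses: the pole along
  \<open>\<omega>\<^sub>1\<^sub>3\<^sub>4 \<omega>\<^sub>2\<^sub>3\<^sub>5 + \<omega>\<^sub>1\<^sub>3\<^sub>5 \<omega>\<^sub>2\<^sub>3\<^sub>4\<close> is spurious (\<open>quadric_without_pole\<close>), and what remains is a
  sum over the five tetrahedra of one bilinear form \<open>tet_form\<close> in \<open>z\<close> and \<open>z'\<close>
  (\<open>zeta_form_decomposition\<close>). Every tetrahedron of the 5-simplex lies in exactly two pentachora, so
  in characteristic 2 the coboundary of \<open>\<zeta>\<close> vanishes (\<open>zeta_cocycle\<close>).

  This does not make \<open>\<zeta>\<close> a coboundary, because \<open>tet_form\<close> is neither symmetric nor zero at
  \<open>z' = \<omega>\<close>. The obstruction already lives on the pentachoron 12345. Let \<open>e\<^sub>a\<^sub>b\<close> be the coloring of the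
  deformation of \<open>b\<^sub>a\<^sub>b\<close> alone. The Pfaffian tensor
  \<open>e\<^sub>2\<^sub>3 e\<^sub>4\<^sub>5 + e\<^sub>2\<^sub>4 e\<^sub>3\<^sub>5 + e\<^sub>2\<^sub>5 e\<^sub>3\<^sub>4\<close> pairs to 0 with every symmetric bilinear form on a
  tetrahedron and to 1 with \<open>\<zeta>\<close> (\<open>zeta_nontrivial\<close>).

  All of this needs only that finitely many polynomials in the \<open>b\<^sub>i\<^sub>j\<close> do not vanish; the product
  of these is the required genericity polynomial (\<open>generic_omega\<close>).
\<close>

section \<open>Identities in characteristic two\<close>

text \<open>
  The symmetric bilinear form \<open>x' x'' / x\<close>, where \<open>x'\<close> and \<open>x''\<close> are two deformations of \<open>x\<close>. It is
  the simplest form with a pole at \<open>x = 0\<close> that pairs the deformation \<open>x' = x\<close> with \<open>x''\<close> regularly;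
  all poles of \<open>\<zeta>\<close> turn out to be of this shape.
\<close>

definition polar :: "'a::field \<Rightarrow> 'a \<Rightarrow> 'a \<Rightarrow> 'a" where
  "polar x x' x'' = x' * x'' / x"

text \<open>
  Partial fractions for a rank one form with three poles. Both sides are forms on a plane that
  contain \<open>(x, y)\<close> in their kernel, so they are proportional.
\<close>

lemma polar_three_terms:
  fixes x y :: "'a::field"
  assumes two: "\<And>x::'a. x + x = 0" and nz: "x \<noteq> 0" "y \<noteq> 0" "x + y \<noteq> 0"
  shows "(y * x' + x * y') * (y * x'' + x * y'') / (x * y * (x + y))
    = polar x x' x'' + polar y y' y'' + polar (x + y) (x' + y') (x'' + y'')"
proof -
  have two': "x + (x + y) = y" for x y :: 'a
    using two[of x] by (metis add.assoc add_0)
  show ?thesis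
    unfolding polar_def using nz by (simp add: divide_simps) (simp add: algebra_simps two two')
qed

text \<open>
  The part of \<open>\<zeta>\<^sub>1\<^sub>2\<^sub>3\<^sub>4\<^sub>5\<close> with denominator \<open>D = \<omega>\<^sub>1\<^sub>3\<^sub>4 \<omega>\<^sub>2\<^sub>3\<^sub>5 + \<omega>\<^sub>1\<^sub>3\<^sub>5 \<omega>\<^sub>2\<^sub>3\<^sub>4\<close>, for \<open>a = \<omega>\<^sub>2\<^sub>3\<^sub>5\<close>,
  \<open>c = \<omega>\<^sub>2\<^sub>3\<^sub>4\<close>, \<open>p = \<omega>\<^sub>1\<^sub>3\<^sub>4\<close>, \<open>q = \<omega>\<^sub>1\<^sub>3\<^sub>5\<close>. Only one pentachoron involves this \<open>D\<close>, so a pole there could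
  never cancel in \<open>\<delta>\<zeta>\<close>. It is absent: the right-hand side has poles only along \<open>\<omega>\<close> of a triangle or
  \<open>\<omega>\<^sub>i\<^sub>j\<^sub>k + \<omega>\<^sub>i\<^sub>j\<^sub>l\<close> of a tetrahedron, plus a form with constant coefficients. The proof compares the ten
  entries of the symmetric matrix in the coordinates \<open>a, c, p, q\<close>.
\<close>

lemma quadric_without_pole:
  fixes a c p q :: "'a::field"
  assumes two: "\<And>x::'a. x + x = 0"
    and nz: "a \<noteq> 0" "c \<noteq> 0" "a + c \<noteq> 0" "p + q \<noteq> 0" "c + p \<noteq> 0" "p * a + q * c \<noteq> 0"
  defines "D \<equiv> p * a + q * c" and "B \<equiv> a + c + p + q"
  defines "\<sigma> \<equiv> \<lambda>a' c' p' q'. (a + q) * (c' + p') + (c + p) * (a' + q')"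
    and "\<rho> \<equiv> \<lambda>p' q'. p * q' + q * p'" and "\<tau> \<equiv> \<lambda>a' c'. c * a' + a * c'"
  shows "p / ((c + p) * D) * (\<sigma> a' c' p' q' * \<sigma> a'' c'' p'' q'')
      + 1 / D * (\<sigma> a' c' p' q' * \<rho> p'' q'' + \<rho> p' q' * \<sigma> a'' c'' p'' q'')
      + B / ((p + q) * D) * (\<rho> p' q' * \<rho> p'' q'')
      + (B * q / (a * (a + c) * D) + (c + p) / (c * a * (a + c))) * (\<tau> a' c' * \<tau> a'' c'')
    = (a + q) * polar (c + p) (c' + p') (c'' + p'') + p * polar (p + q) (p' + q') (p'' + q'')
      + (c + B) * polar (a + c) (a' + c') (a'' + c'') + p * polar c c' c'' + q * polar a a' a''
      + (a' * a'' + p' * p'' + (a' * p'' + p' * a'') + (p' * q'' + q' * p''))"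
    (is "?k1 * _ + ?k2 * _ + ?k3 * _ + ?k4 * _ = _")
proof -
  have two': "x + (x + y) = y" for x y :: 'a
    using two[of x] by (metis add.assoc add_0)
  have D: "D \<noteq> 0" using nz D_def by simp
  have z2: "(2::'a) = 0" using two[of 1] by simp
  note clear = nz D
  have aa: "?k1 * (c + p) * (c + p) + ?k4 * c * c = (c + B) / (a + c) + q / a + 1"
    using clear by (simp add: divide_simps) (simp add: D_def B_def algebra_simps two two' z2)
  have ac: "?k1 * (c + p) * (a + q) + ?k4 * c * a = (c + B) / (a + c)"
    using clear by (simp add: divide_simps) (simp add: D_def B_def algebra_simps two two' z2)
  have cc: "?k1 * (a + q) * (a + q) + ?k4 * a * a = (a + q) / (c + p) + (c + B) / (a + c) + p / c"
    using clear by (simp add: divide_simps) (simp add: D_def B_def algebra_simps two two' z2)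
  have ap: "?k1 * (c + p) * (a + q) + ?k2 * (c + p) * q = 1"
    using clear by (simp add: divide_simps) (simp add: D_def B_def algebra_simps two two' z2)
  have aq: "?k1 * (c + p) * (c + p) + ?k2 * (c + p) * p = 0"
    using clear by (simp add: divide_simps) (simp add: D_def B_def algebra_simps two two' z2)
  have cp: "?k1 * (a + q) * (a + q) + ?k2 * (a + q) * q = (a + q) / (c + p)"
    using clear by (simp add: divide_simps) (simp add: D_def B_def algebra_simps two two' z2)
  have cq: "?k1 * (a + q) * (c + p) + ?k2 * (a + q) * p = 0"
    using clear by (simp add: divide_simps) (simp add: D_def B_def algebra_simps two two' z2)
  have pp: "?k1 * (a + q) * (a + q) + ?k3 * q * q = (a + q) / (c + p) + p / (p + q) + 1"
    using clear by (simp add: divide_simps) (simp add: D_def B_def algebra_simps two two' z2)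
  have pq: "?k1 * (a + q) * (c + p) + ?k2 * ((a + q) * p + (c + p) * q) + ?k3 * p * q
      = p / (p + q) + 1"
    using clear by (simp add: divide_simps) (simp add: D_def B_def algebra_simps two two' z2)
  have qq: "?k1 * (c + p) * (c + p) + ?k3 * p * p = p / (p + q)"
    using clear by (simp add: divide_simps) (simp add: D_def B_def algebra_simps two two' z2)
  have expand: "k1 * (\<sigma> a' c' p' q' * \<sigma> a'' c'' p'' q'')
      + k2 * (\<sigma> a' c' p' q' * \<rho> p'' q'' + \<rho> p' q' * \<sigma> a'' c'' p'' q'')
      + k3 * (\<rho> p' q' * \<rho> p'' q'') + k4 * (\<tau> a' c' * \<tau> a'' c'')
    = (k1 * (c + p) * (c + p) + k4 * c * c) * (a' * a'')
      + (k1 * (c + p) * (a + q) + k4 * c * a) * (a' * c'' + c' * a'')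
      + (k1 * (a + q) * (a + q) + k4 * a * a) * (c' * c'')
      + (k1 * (c + p) * (a + q) + k2 * (c + p) * q) * (a' * p'' + p' * a'')
      + (k1 * (c + p) * (c + p) + k2 * (c + p) * p) * (a' * q'' + q' * a'')
      + (k1 * (a + q) * (a + q) + k2 * (a + q) * q) * (c' * p'' + p' * c'')
      + (k1 * (a + q) * (c + p) + k2 * (a + q) * p) * (c' * q'' + q' * c'')
      + (k1 * (a + q) * (a + q) + k3 * q * q) * (p' * p'')
      + (k1 * (a + q) * (c + p) + k2 * ((a + q) * p + (c + p) * q) + k3 * p * q)
          * (p' * q'' + q' * p'')
      + (k1 * (c + p) * (c + p) + k3 * p * p) * (q' * q'')" for k1 k2 k3 k4
    unfolding \<sigma>_def \<rho>_def \<tau>_def by (simp add: algebra_simps two two' z2)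
  show ?thesis
    unfolding expand aa ac cc ap aq cp cq pp pq qq polar_def
    by (simp add: algebra_simps add_divide_distrib)
qed

section \<open>The form on a pentachoron as a sum over its tetrahedra\<close>

text \<open>
  Signs are omitted because this is used only in characteristic 2. Solved for one face, the condition
  can be used directly for rewriting.
\<close>

definition cocycle :: "(nat \<Rightarrow> nat \<Rightarrow> nat \<Rightarrow> 'a::field) \<Rightarrow> bool" where
  "cocycle z \<longleftrightarrow> (\<forall>i j k l. 1 \<le> i \<and> i < j \<and> j < k \<and> k < l \<and> l \<le> 6 \<longrightarrow>
     z j k l = z i j k + z i j l + z i k l)"

locale generic_cocycle =
  fixes w :: "nat \<Rightarrow> nat \<Rightarrow> nat \<Rightarrow> 'a::field"
  assumes two: "\<And>x::'a. x + x = 0"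
    and cocycle_w: "cocycle w"
    and w_nonzero: "\<And>i j k. 1 \<le> i \<Longrightarrow> i < j \<Longrightarrow> j < k \<Longrightarrow> k \<le> 6 \<Longrightarrow> w i j k \<noteq> 0"
    and kappa_nonzero: "\<And>i j k l. 1 \<le> i \<Longrightarrow> i < j \<Longrightarrow> j < k \<Longrightarrow> k < l \<Longrightarrow> l \<le> 6 \<Longrightarrow>
      w i j k + w i j l \<noteq> 0"
    and D_nonzero: "\<And>i j k l m. 1 \<le> i \<Longrightarrow> i < j \<Longrightarrow> j < k \<Longrightarrow> k < l \<Longrightarrow> l < m \<Longrightarrow> m \<le> 6 \<Longrightarrow>
      w i k l * w j k m + w i k m * w j k l \<noteq> 0"
begin

lemma two': "x + (x + y) = (y::'a)"
  using two[of x] by (metis add.assoc add_0)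

lemma two_eq_zero: "(2::'a) = 0"
  using two[of 1] by simp

lemma last_of_zero_sum: "x + y + t = 0 \<Longrightarrow> t = x + (y::'a)"
  by (metis add_0_right two')

lemmas char_two = two two' two_eq_zero

text \<open>
  The column on \<open>ijkl\<close> of the coloring with potential \<open>z / w\<close> on the triangles: the functional of the
  edge \<open>ij\<close> involves only the first component and that of \<open>kl\<close> only the second, both with the
  coefficient \<open>w\<^sub>i\<^sub>j\<^sub>k + w\<^sub>i\<^sub>j\<^sub>l = w\<^sub>i\<^sub>k\<^sub>l + w\<^sub>j\<^sub>k\<^sub>l\<close>, and they have to give the differences of the potential.
\<close>

definition tet_color :: "(nat \<Rightarrow> nat \<Rightarrow> nat \<Rightarrow> 'a) \<Rightarrow> nat \<Rightarrow> nat \<Rightarrow> nat \<Rightarrow> nat \<Rightarrow> 'a \<times> 'a" where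
  "tet_color z i j k l =
     ((z i j k / w i j k + z i j l / w i j l) / (w i j k + w i j l),
      (z i k l / w i k l + z j k l / w j k l) / (w i j k + w i j l))"

text \<open>
  For \<open>z = w\<close> the polar terms cancel the regular ones, so \<open>z\<close> matters only through its coloring.
  For \<open>z' = w\<close> nothing cancels, and the form is not symmetric: it is not a cochain on colorings, and
  writing \<open>\<zeta>\<close> as a sum of such forms does not exhibit it as a coboundary.
\<close>

definition tet_form ::
    "(nat \<Rightarrow> nat \<Rightarrow> nat \<Rightarrow> 'a) \<Rightarrow> (nat \<Rightarrow> nat \<Rightarrow> nat \<Rightarrow> 'a) \<Rightarrow> nat \<Rightarrow> nat \<Rightarrow> nat \<Rightarrow> nat \<Rightarrow> 'a" where
  "tet_form z z' i j k l =
     w i j k * polar (w i j k + w i j l) (z i j k + z i j l) (z' i j k + z' i j l)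
     + z i j k * (z' i j k + z' i j l)
     + w i k l * polar (w j k l) (z j k l) (z' j k l) + z i k l * z' j k l"

text \<open>
  The terms of \<open>\<zeta>\<close> are products of the four linear forms \<open>\<sigma>, \<rho>, \<tau>, \<theta>\<close> in \<open>z\<close>, obtained from the
  components of the coloring by clearing denominators. The pairs \<open>\<sigma>\<sigma>'\<close> and \<open>\<theta>\<theta>'\<close> split by
  \<open>polar_three_terms\<close>, the rest by \<open>quadric_without_pole\<close>; the coefficients of the resulting polar
  forms are then those of \<open>tet_form\<close>, and the remaining constant forms agree by the cocycle
  relations.
\<close>

lemma zeta_form_decomposition:
  assumes ord: "1 \<le> i" "i < j" "j < k" "k < l" "l < m" "m \<le> 6"
    and z: "cocycle z" "cocycle z'"
    and p: "p {i,j,k,m} = tet_color z i j k m" "p {i,j,l,m} = tet_color z i j l m"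
      "p {i,k,l,m} = tet_color z i k l m" "p {j,k,l,m} = tet_color z j k l m"
    and q: "q {i,j,k,m} = tet_color z' i j k m" "q {i,j,l,m} = tet_color z' i j l m"
      "q {i,k,l,m} = tet_color z' i k l m" "q {j,k,l,m} = tet_color z' j k l m"
  shows "zeta_form w i j k l m p q =
    tet_form z z' i j k l + tet_form z z' i j k m + tet_form z z' i j l m
    + tet_form z z' i k l m + tet_form z z' j k l m"
proof -
  define A B C E G D where "A = w i j k + w i j m" and "B = w i j l + w i j m"
    and "C = w i j k + w i j l" and "E = w i k l + w i k m" and "G = w j k l + w j k m"
    and "D = w i k l * w j k m + w i k m * w j k l"
  define \<sigma> \<rho> \<tau> \<theta> where "\<sigma> u = A * (u i j k + u i j l) + C * (u i j k + u i j m)"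
    and "\<rho> u = w i k l * u i k m + w i k m * u i k l"
    and "\<tau> u = w j k l * u j k m + w j k m * u j k l"
    and "\<theta> u = w k l m * u j l m + w j l m * u k l m" for u :: "nat \<Rightarrow> nat \<Rightarrow> nat \<Rightarrow> 'a"
  have coc: "w j k l = w i j k + w i j l + w i k l" "w j k m = w i j k + w i j m + w i k m"
     "w j l m = w i j l + w i j m + w i l m" "w k l m = w i k l + w i k m + w i l m"
     "z j k l = z i j k + z i j l + z i k l" "z j k m = z i j k + z i j m + z i k m"
     "z j l m = z i j l + z i j m + z i l m" "z k l m = z i k l + z i k m + z i l m"
     "z' j k l = z' i j k + z' i j l + z' i k l" "z' j k m = z' i j k + z' i j m + z' i k m"
     "z' j l m = z' i j l + z' i j m + z' i l m" "z' k l m = z' i k l + z' i k m + z' i l m"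
    using cocycle_w z ord unfolding cocycle_def by (simp_all)
  have nz: "A \<noteq> 0" "B \<noteq> 0" "C \<noteq> 0" "E \<noteq> 0" "G \<noteq> 0" "D \<noteq> 0"
    using kappa_nonzero D_nonzero ord unfolding A_def B_def C_def E_def G_def D_def by auto
  have wnz: "w i j k \<noteq> 0" "w i j l \<noteq> 0" "w i j m \<noteq> 0" "w i k l \<noteq> 0" "w i k m \<noteq> 0"
     "w i l m \<noteq> 0" "w j k l \<noteq> 0" "w j k m \<noteq> 0" "w j l m \<noteq> 0" "w k l m \<noteq> 0"
    using w_nonzero ord by auto
  define X where "X = (\<lambda>u. w i j k * fst (tet_color u i j k m) + w i j l * fst (tet_color u i j l m))"
  have X: "X u = \<sigma> u / (A * B)" for u
    unfolding X_def \<sigma>_def tet_color_def fst_conv A_def[symmetric] B_def[symmetric]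
    using nz wnz
    by (simp add: divide_simps) (simp add: A_def B_def C_def algebra_simps char_two)
  have R: "w i k l * w i k m * E * fst (tet_color u i k l m) = \<rho> u" for u
    unfolding \<rho>_def tet_color_def fst_conv E_def[symmetric]
    using nz wnz by (simp add: divide_simps)
  have T: "w j k l * w j k m * G * fst (tet_color u j k l m) = \<tau> u" for u
    unfolding \<tau>_def tet_color_def fst_conv G_def[symmetric]
    using nz wnz by (simp add: divide_simps)
  have Y: "w j l m * w k l m * G * snd (tet_color u j k l m) = \<theta> u" for u
    unfolding \<theta>_def tet_color_def snd_conv G_def[symmetric]
    using nz wnz by (simp add: divide_simps)
  have G': "w j l m + w k l m = G"
    unfolding G_def coc by (simp add: algebra_simps char_two)
  have B': "w j l m + w i l m = B"
    unfolding B_def coc by (simp add: algebra_simps char_two)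
  define Om where "Om = Omega w i j k l m"
  \<comment> \<open>The two expressions of \<open>\<Omega>\<close> modulo \<open>D\<close> separate the pole at \<open>D\<close> from the other poles.\<close>
  have Om: "Om = w i j m * D + w i k l * A * B" "Om = w i j l * D + w i k m * B * C"
    unfolding Om_def Omega_def A_def B_def C_def D_def coc by (simp_all add: algebra_simps char_two)
  have "zeta_form w i j k l m p q =
      A * B * Om / (C * D) * (X z * X z')
    + A * B / D * (X z * (w i k l * w i k m * E * fst (tet_color z' i k l m))
                 + (w i k l * w i k m * E * fst (tet_color z i k l m)) * X z')
    + B / (E * D) * ((w i k l * w i k m * E * fst (tet_color z i k l m))
                 * (w i k l * w i k m * E * fst (tet_color z' i k l m)))
    + ((Om + B * w i k l * w i k m) / (w j k l * w j k m * G * D) + w i j k / (w j k l * w j k m * G))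
       * ((w j k l * w j k m * G * fst (tet_color z j k l m))
                 * (w j k l * w j k m * G * fst (tet_color z' j k l m)))
    + B / (w j l m * w k l m * G) * ((w j l m * w k l m * G * snd (tet_color z j k l m))
                 * (w j l m * w k l m * G * snd (tet_color z' j k l m)))"
  proof -
    have eqs: "w i j m + w i j k = A" "w i j m + w i j l = B" "w i j l + w i j k = C"
      "w i k m + w i k l = E" "w j k m + w j k l = G" "Omega w i j k l m = Om"
      by (simp_all add: A_def B_def C_def E_def G_def Om_def add.commute)
    have t: "B * (w i k l)\<^sup>2 * (w i k m)\<^sup>2 * E / D * (x * x')
        = B / (E * D) * ((w i k l * w i k m * E * x) * (w i k l * w i k m * E * x'))"
      "w j k l * w j k m * G * (Om + w i j m * w i k l * w i k m + w i j l * w i k l * w i k m) / D * (x * x')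
        = (Om + B * w i k l * w i k m) / (w j k l * w j k m * G * D)
          * ((w j k l * w j k m * G * x) * (w j k l * w j k m * G * x'))"
      "w i j k * w j k l * w j k m * G * (x * x') = w i j k / (w j k l * w j k m * G)
          * ((w j k l * w j k m * G * x) * (w j k l * w j k m * G * x'))"
      "B * G * w j l m * w k l m * (x * x') = B / (w j l m * w k l m * G)
          * ((w j l m * w k l m * G * x) * (w j l m * w k l m * G * x'))" for x x'
      using nz wnz
      by (simp_all add: divide_simps power2_eq_square) (simp_all add: B_def algebra_simps)
    show ?thesis
      unfolding zeta_form_def Let_def p q eqs G' B' D_def[symmetric] X_def t
      by (simp add: algebra_simps power2_eq_square add_divide_distrib)
  qed
  also have "\<dots> = Om / (A * B * C * D) * (\<sigma> z * \<sigma> z')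
    + 1 / D * (\<sigma> z * \<rho> z' + \<rho> z * \<sigma> z')
    + B / (E * D) * (\<rho> z * \<rho> z')
    + ((Om + B * w i k l * w i k m) / (w j k l * w j k m * G * D) + w i j k / (w j k l * w j k m * G))
       * (\<tau> z * \<tau> z')
    + B / (w j l m * w k l m * G) * (\<theta> z * \<theta> z')"
    unfolding R T Y X using nz by (simp add: field_simps)
  also have "Om / (A * B * C * D) = w i j m / (A * B * C) + w i k l / (C * D)"
    unfolding Om(1) using nz by (simp add: field_simps)
  also have "(Om + B * w i k l * w i k m) / (w j k l * w j k m * G * D) + w i j k / (w j k l * w j k m * G)
     = B * w i k m / (w j k m * G * D) + C / (w j k l * w j k m * G)"
  proof -
    have 1: "Om + B * w i k l * w i k m = w i j l * D + B * w i k m * w j k l"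
      unfolding Om(2) coc C_def by (simp add: algebra_simps char_two)
    show ?thesis unfolding 1 using nz wnz
      by (simp add: divide_simps) (simp add: C_def algebra_simps)
  qed
  finally have form: "zeta_form w i j k l m p q =
      w i j m * (\<sigma> z * \<sigma> z' / (A * B * C))
    + (w i k l / (C * D) * (\<sigma> z * \<sigma> z') + 1 / D * (\<sigma> z * \<rho> z' + \<rho> z * \<sigma> z')
       + B / (E * D) * (\<rho> z * \<rho> z')
       + (B * w i k m / (w j k m * G * D) + C / (w j k l * w j k m * G)) * (\<tau> z * \<tau> z'))
    + B * (\<theta> z * \<theta> z' / (w j l m * w k l m * G))"
    by (simp add: algebra_simps)
  have sums: "A + C = B" "w j k l + w i k l = C" "w j k m + w i k m = A" "w j k m + w j k l = G"
    "G + w i k l + w i k m = B"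
    unfolding A_def B_def C_def G_def coc by (simp_all add: algebra_simps char_two)
  define qA qB qC qE qG where "qA = polar A (z i j k + z i j m) (z' i j k + z' i j m)"
    and "qB = polar B (z i j l + z i j m) (z' i j l + z' i j m)"
    and "qC = polar C (z i j k + z i j l) (z' i j k + z' i j l)"
    and "qE = polar E (z i k l + z i k m) (z' i k l + z' i k m)"
    and "qG = polar G (z j k l + z j k m) (z' j k l + z' j k m)"
  define q' where "q' a b c = polar (w a b c) (z a b c) (z' a b c)" for a b c
  have \<sigma>: "\<sigma> z * \<sigma> z' / (A * B * C) = qA + qB + qC"
  proof -
    have "\<sigma> z * \<sigma> z' / (A * B * C) = \<sigma> z * \<sigma> z' / (A * C * (A + C))"
      unfolding sums by (simp add: ac_simps)
    also have "\<dots> = qA + qC + polar (A + C) (z i j k + z i j m + (z i j k + z i j l))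
        (z' i j k + z' i j m + (z' i j k + z' i j l))"
      unfolding qA_def qC_def \<sigma>_def
      by (subst polar_three_terms[OF two, symmetric]) (use nz sums in \<open>simp_all add: add.commute\<close>)
    also have "\<dots> = qA + qC + qB"
      unfolding qB_def sums by (simp add: algebra_simps char_two)
    finally show ?thesis by (simp add: ac_simps)
  qed
  have \<theta>: "\<theta> z * \<theta> z' / (w j l m * w k l m * G) = q' j l m + q' k l m + qG"
  proof -
    have "\<theta> z * \<theta> z' / (w j l m * w k l m * (w j l m + w k l m))
       = q' j l m + q' k l m + polar (w j l m + w k l m) (z j l m + z k l m) (z' j l m + z' k l m)"
      unfolding q'_def \<theta>_def
      by (subst polar_three_terms[OF two, symmetric]) (use nz wnz G' in \<open>simp_all add: add.commute\<close>)
    also have "z j l m + z k l m = z j k l + z j k m" unfolding coc by (simp add: algebra_simps char_two)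
    also have "z' j l m + z' k l m = z' j k l + z' j k m" unfolding coc by (simp add: algebra_simps char_two)
    finally show ?thesis unfolding G' qG_def .
  qed
  have K: "w i k l / (C * D) * (\<sigma> z * \<sigma> z') + 1 / D * (\<sigma> z * \<rho> z' + \<rho> z * \<sigma> z')
       + B / (E * D) * (\<rho> z * \<rho> z')
       + (B * w i k m / (w j k m * G * D) + C / (w j k l * w j k m * G)) * (\<tau> z * \<tau> z')
     = A * qC + w i k l * qE + (w j k l + B) * qG + w i k l * q' j k l + w i k m * q' j k m
       + (z j k m * z' j k m + z i k l * z' i k l + (z j k m * z' i k l + z i k l * z' j k m)
          + (z i k l * z' i k m + z i k m * z' i k l))"
  proof -
    have u: "u j k l + u i k l = u i j k + u i j l" "u j k m + u i k m = u i j k + u i j m"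
      "u j k m + u j k l = u j k l + u j k m"
      if "u j k l = u i j k + u i j l + u i k l" "u j k m = u i j k + u i j m + u i k m"
      for u :: "nat \<Rightarrow> nat \<Rightarrow> nat \<Rightarrow> 'a"
      unfolding that by (simp_all add: algebra_simps char_two)
    have "w j k m \<noteq> 0" "w j k l \<noteq> 0" "w j k m + w j k l \<noteq> 0" "w i k l + w i k m \<noteq> 0"
      "w j k l + w i k l \<noteq> 0" "w i k l * w j k m + w i k m * w j k l \<noteq> 0"
      using nz wnz unfolding sums D_def E_def by auto
    from quadric_without_pole[OF two this,
        where a' = "z j k m" and c' = "z j k l" and p' = "z i k l" and q' = "z i k m"
          and a'' = "z' j k m" and c'' = "z' j k l" and p'' = "z' i k l" and q'' = "z' i k m"]
    show ?thesis
      unfolding sums D_def[symmetric] E_def[symmetric] u[OF coc(5,6)] u[OF coc(9,10)]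
        qA_def[symmetric] qB_def[symmetric] qC_def[symmetric] qE_def[symmetric] qG_def[symmetric]
        q'_def[symmetric] \<sigma>_def \<rho>_def \<tau>_def
      by (simp only: mult.assoc add.assoc)
  qed
  have polarA: "A * qA = (z i j k + z i j m) * (z' i j k + z' i j m)"
    and polarB: "B * qB = (z i j l + z i j m) * (z' i j l + z' i j m)"
    and polar': "w j l m * q' j l m = z j l m * z' j l m"
    unfolding qA_def qB_def q'_def polar_def using nz wnz by simp_all
  have "zeta_form w i j k l m p q =
      w i j k * qC + w i j k * qA + w i j l * qB + w i k l * qE + w j k l * qG
      + w i k l * q' j k l + w i k m * q' j k m + w i l m * q' j l m + (w i l m + w j l m) * q' k l m
      + (A * qA + B * qB + w j l m * q' j l m
         + (z j k m * z' j k m + z i k l * z' i k l + (z j k m * z' i k l + z i k l * z' j k m)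
          + (z i k l * z' i k m + z i k m * z' i k l)))"
    unfolding form \<sigma> \<theta> K
    by (simp add: A_def B_def C_def coc(3) algebra_simps char_two)
  also have "A * qA + B * qB + w j l m * q' j l m
         + (z j k m * z' j k m + z i k l * z' i k l + (z j k m * z' i k l + z i k l * z' j k m)
          + (z i k l * z' i k m + z i k m * z' i k l)) =
      z i j k * (z' i j k + z' i j l) + z i k l * z' j k l
    + z i j k * (z' i j k + z' i j m) + z i k m * z' j k m
    + z i j l * (z' i j l + z' i j m) + z i l m * z' j l m
    + z i k l * (z' i k l + z' i k m) + z i l m * z' k l m
    + z j k l * (z' j k l + z' j k m) + z j l m * z' k l m"
    unfolding polarA polarB polar' unfolding coc by (simp add: algebra_simps char_two)
  finally show ?thesis
    unfolding tet_form_def A_def[symmetric] B_def[symmetric] C_def[symmetric] E_def[symmetric] G_def[symmetric]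
      qA_def[symmetric] qB_def[symmetric] qC_def[symmetric] qE_def[symmetric] qG_def[symmetric]
      q'_def[symmetric]
    by (simp add: algebra_simps)
qed

section \<open>Permitted colorings come from 2-cocycles\<close>

lemma sorted4: "i < j \<Longrightarrow> j < k \<Longrightarrow> k < l \<Longrightarrow> sorted_list_of_set {i,j,k,l::nat} = [i,j,k,l]"
  using sorted_list_of_set.idem_if_sorted_distinct[of "[i,j,k,l]"] by simp

lemma sorted5: "i < j \<Longrightarrow> j < k \<Longrightarrow> k < l \<Longrightarrow> l < m \<Longrightarrow>
    sorted_list_of_set {i,j,k,l,m::nat} = [i,j,k,l,m]"
  using sorted_list_of_set.idem_if_sorted_distinct[of "[i,j,k,l,m]"] by simp

definition edge_value :: "'a coloring \<Rightarrow> nat set \<Rightarrow> nat set \<Rightarrow> 'a" where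
  "edge_value p t e = fst (edge_row w t e) * fst (p t) + snd (edge_row w t e) * snd (p t)"

lemma edge_value_simps:
  assumes "i < j" "j < k" "k < l"
  shows "edge_value p {i,j,k,l} {i,j} = (w j k l + w i k l) * fst (p {i,j,k,l})"
    "edge_value p {i,j,k,l} {i,k} = w i j l * fst (p {i,j,k,l}) + w j k l * snd (p {i,j,k,l})"
    "edge_value p {i,j,k,l} {i,l} = w i j k * fst (p {i,j,k,l}) + w j k l * snd (p {i,j,k,l})"
    "edge_value p {i,j,k,l} {j,k} = w i j l * fst (p {i,j,k,l}) + w i k l * snd (p {i,j,k,l})"
    "edge_value p {i,j,k,l} {j,l} = w i j k * fst (p {i,j,k,l}) + w i k l * snd (p {i,j,k,l})"
    "edge_value p {i,j,k,l} {k,l} = (w i j k + w i j l) * snd (p {i,j,k,l})"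
  using assms unfolding edge_value_def edge_row_def sorted4[OF assms]
  by (simp_all add: doubleton_eq_iff)

lemma faces_codim_one:
  assumes "card u = n + 2"
  shows "faces n u = (\<lambda>v. u - {v}) ` u"
proof -
  have fin: "finite u" using assms by (metis card.infinite add_2_eq_Suc' nat.distinct(1))
  have "t \<in> (\<lambda>v. u - {v}) ` u" if "t \<subseteq> u" "card t = n + 1" for t
  proof -
    have "card (u - t) = 1" using that assms fin by (simp add: card_Diff_subset finite_subset)
    then obtain v where "u - t = {v}" by (auto simp: card_1_singleton_iff)
    then have "t = u - {v}" "v \<in> u" using that by auto
    then show ?thesis by auto
  qed
  then show ?thesis using assms fin by (auto simp: faces_def)
qed

lemma edge_functional_restr:
  assumes "card u = 5" "e \<subseteq> u"
  shows "edge_functional w u e (restr u p) = (\<Sum>v\<in>u - e. edge_value p (u - {v}) e)"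
proof -
  have "{t \<in> faces 3 u. e \<subseteq> t} = (\<lambda>v. u - {v}) ` (u - e)"
    using assms by (auto simp: faces_codim_one)
  moreover have "inj_on (\<lambda>v. u - {v}) (u - e)"
    by (auto simp: inj_on_def)
  moreover have "u - {v} \<in> faces 3 u" if "v \<in> u" for v
    using assms that by (auto simp: faces_codim_one)
  ultimately show ?thesis
    by (simp add: edge_functional_def sum.reindex edge_value_def restr_def)
qed

text \<open>
  Exactly three tetrahedra of a pentachoron contain a given edge; naming the vertices of the edge
  first avoids a separate statement for each of the ten edges.
\<close>

lemma edge_functional_star:
  assumes "distinct [a, b, c, d, e]"
  shows "edge_functional w {a,b,c,d,e} {a,b} (restr {a,b,c,d,e} p)
    = edge_value p {a,b,c,d} {a,b} + edge_value p {a,b,c,e} {a,b} + edge_value p {a,b,d,e} {a,b}"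
proof -
  have ne: "a \<noteq> b" "a \<noteq> c" "a \<noteq> d" "a \<noteq> e" "b \<noteq> c" "b \<noteq> d" "b \<noteq> e" "c \<noteq> d" "c \<noteq> e" "d \<noteq> e"
    using assms by auto
  have "card {a,b,c,d,e} = 5"
    using ne by simp
  then show ?thesis
    using ne ne[symmetric] by (simp add: edge_functional_restr insert_Diff_if algebra_simps)
qed

lemma permitted_star:
  assumes p: "p \<in> permitted w s" and sub: "{a,b,c,d,e} \<subseteq> s" and dist: "distinct [a, b, c, d, e]"
    and t: "t\<^sub>1 = {a,b,c,d}" "t\<^sub>2 = {a,b,c,e}" "t\<^sub>3 = {a,b,d,e}"
  shows "edge_value p t\<^sub>3 {a,b} = edge_value p t\<^sub>1 {a,b} + edge_value p t\<^sub>2 {a,b}"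
proof -
  have "{a,b,c,d,e} \<in> faces 4 s" "{a,b} \<in> faces 1 {a,b,c,d,e}"
    using sub dist by (auto simp: faces_def)
  then have "edge_functional w {a,b,c,d,e} {a,b} (restr {a,b,c,d,e} p) = 0"
    using p unfolding permitted_def by blast
  then show ?thesis
    unfolding edge_functional_star[OF dist] t by (rule last_of_zero_sum)
qed

definition potential_on ::
    "'a coloring \<Rightarrow> (nat \<Rightarrow> nat \<Rightarrow> nat \<Rightarrow> 'a) \<Rightarrow> nat \<Rightarrow> nat \<Rightarrow> nat \<Rightarrow> nat \<Rightarrow> bool" where
  "potential_on p u i j k l \<longleftrightarrow>
     edge_value p {i,j,k,l} {i,j} = u i j k + u i j l \<and>
     edge_value p {i,j,k,l} {i,k} = u i j k + u i k l \<and>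
     edge_value p {i,j,k,l} {i,l} = u i j l + u i k l \<and>
     edge_value p {i,j,k,l} {j,k} = u i j k + u j k l \<and>
     edge_value p {i,j,k,l} {j,l} = u i j l + u j k l \<and>
     edge_value p {i,j,k,l} {k,l} = u i k l + u j k l"

text \<open>
  The edges \<open>ij\<close>, \<open>ik\<close>, \<open>jk\<close> join the triangle \<open>ijk\<close> to the other three, so they determine the
  potential up to a constant; the other three edge values follow from the cocycle relation for \<open>w\<close>.
\<close>

lemma potential_onI:
  assumes ord: "1 \<le> i" "i < j" "j < k" "k < l" "l \<le> 6"
    and "edge_value p {i,j,k,l} {i,j} = u i j k + u i j l"
    "edge_value p {i,j,k,l} {i,k} = u i j k + u i k l"
    "edge_value p {i,j,k,l} {j,k} = u i j k + u j k l"
  shows "potential_on p u i j k l"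
proof -
  have c: "w j k l = w i j k + w i j l + w i k l"
    using cocycle_w ord unfolding cocycle_def by simp
  have u: "u i j l = u i j k + edge_value p {i,j,k,l} {i,j}"
    "u i k l = u i j k + edge_value p {i,j,k,l} {i,k}"
    "u j k l = u i j k + edge_value p {i,j,k,l} {j,k}"
    using assms by (simp_all add: two')
  show ?thesis
    using ord unfolding potential_on_def u edge_value_simps[OF ord(2-4)] c
    by (simp add: algebra_simps char_two)
qed

lemma potential_on_cocycle:
  assumes ord: "1 \<le> i" "i < j" "j < k" "k < l" "l \<le> 6" and u: "potential_on p u i j k l"
  shows "w j k l * u j k l = w i j k * u i j k + w i j l * u i j l + w i k l * u i k l"
proof -
  have c: "w j k l = w i j k + w i j l + w i k l"
    using cocycle_w ord unfolding cocycle_def by simp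
  have u: "u i j l = u i j k + edge_value p {i,j,k,l} {i,j}"
    "u i k l = u i j k + edge_value p {i,j,k,l} {i,k}"
    "u j k l = u i j k + edge_value p {i,j,k,l} {j,k}"
    using u unfolding potential_on_def by (simp_all add: two')
  show ?thesis
    unfolding u edge_value_simps[OF ord(2-4)] c
    by (simp add: algebra_simps char_two)
qed

lemma potential_on_color:
  assumes ord: "1 \<le> i" "i < j" "j < k" "k < l" "l \<le> 6" and u: "potential_on p u i j k l"
  shows "p {i,j,k,l} = tet_color (\<lambda>a b c. w a b c * u a b c) i j k l"
proof -
  have c: "w j k l + w i k l = w i j k + w i j l"
    using cocycle_w ord unfolding cocycle_def by (simp add: algebra_simps char_two)
  have "(w i j k + w i j l) * fst (p {i,j,k,l}) = u i j k + u i j l"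
    "(w i j k + w i j l) * snd (p {i,j,k,l}) = u i k l + u j k l"
    using u unfolding potential_on_def edge_value_simps[OF ord(2-4)] c by simp_all
  then show ?thesis
    using kappa_nonzero[OF ord] w_nonzero ord
    by (simp add: tet_color_def prod_eq_iff eq_divide_eq mult.commute)
qed

text \<open>
  The potential is integrated outward from the triangle 123: first to the triangles containing 12,
  then to those containing 1, then to all. The edge conditions of a pentachoron through 12, or
  through 1, give the tetrahedra not used in the construction.
\<close>

lemma permitted_has_potential:
  assumes p: "p \<in> permitted w {1..6}"
  obtains u where "\<And>i j k l. 1 \<le> i \<Longrightarrow> i < j \<Longrightarrow> j < k \<Longrightarrow> k < l \<Longrightarrow> l \<le> 6 \<Longrightarrow> potential_on p u i j k l"
proof -
  note [simp del] = One_nat_def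
  define u2 where "u2 k = (if k = 3 then 0 else edge_value p {1,2,3,k} {1,2})" for k
  define u1 where "u1 j k = (if j = 2 then u2 k else u2 j + edge_value p {1,2,j,k} {1,j})" for j k
  define u where "u i j k = (if i = 1 then u1 j k else u1 i j + edge_value p {1,i,j,k} {i,j})"
    for i j k
  have u12: "u 1 2 k = u2 k" for k by (simp add: u_def u1_def)
  have u1: "u 1 j k = u2 j + edge_value p {1,2,j,k} {1,j}" if "j > 2" for j k
    using that by (simp add: u_def u1_def)
  have u: "u i j k = u 1 i j + edge_value p {1,i,j,k} {i,j}" if "i > 1" for i j k
    using that by (simp add: u_def)
  have tet12: "potential_on p u 1 2 k l" if "2 < k" "k < l" "l \<le> 6" for k l
  proof (rule potential_onI)
    show "edge_value p {1, 2, k, l} {1, 2} = u 1 2 k + u 1 2 l"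
    proof (cases "k = 3")
      case False
      then have "u2 k = edge_value p {1,2,3,k} {1,2}" "u2 l = edge_value p {1,2,3,l} {1,2}"
        using that by (auto simp: u2_def)
      moreover have "edge_value p {1,2,k,l} {1,2} = edge_value p {1,2,3,k} {1,2} + edge_value p {1,2,3,l} {1,2}"
        by (rule permitted_star[OF p, of 1 2 3 k l]) (use that False in auto)
      ultimately show ?thesis unfolding u12 by simp
    qed (use that in \<open>simp add: u12 u2_def\<close>)
  qed (use that in \<open>simp_all add: u12 u1 u[of 2] two'\<close>)
  have tet1: "potential_on p u 1 j k l" if ord: "2 < j" "j < k" "k < l" "l \<le> 6" for j k l
  proof (rule potential_onI)
    have P: "potential_on p u 1 2 j k" "potential_on p u 1 2 j l" "potential_on p u 1 2 k l"
      using ord by (auto intro: tet12)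
    have "edge_value p {1,j,k,l} {1,j} = edge_value p {1,2,j,k} {1,j} + edge_value p {1,2,j,l} {1,j}"
      by (rule permitted_star[OF p, of 1 j 2 k l]) (use ord in auto)
    then show "edge_value p {1,j,k,l} {1,j} = u 1 j k + u 1 j l"
      using P unfolding potential_on_def by (simp add: algebra_simps char_two)
    have "edge_value p {1,j,k,l} {1,k} = edge_value p {1,2,j,k} {1,k} + edge_value p {1,2,k,l} {1,k}"
      by (rule permitted_star[OF p, of 1 k 2 j l]) (use ord in auto)
    then show "edge_value p {1,j,k,l} {1,k} = u 1 j k + u 1 k l"
      using P unfolding potential_on_def by (simp add: algebra_simps char_two)
  qed (use that in \<open>simp_all add: u two'\<close>)
  have tet: "potential_on p u i j k l" if ord: "1 < i" "i < j" "j < k" "k < l" "l \<le> 6" for i j k l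
  proof (rule potential_onI)
    have P: "potential_on p u 1 i j k" "potential_on p u 1 i j l" "potential_on p u 1 i k l"
       "potential_on p u 1 j k l"
      using ord tet1 tet12 by (cases "i = 2"; auto)+
    have "edge_value p {i,j,k,l} {i,j} = edge_value p {1,i,j,k} {i,j} + edge_value p {1,i,j,l} {i,j}"
      by (rule permitted_star[OF p, of i j 1 k l]) (use ord in auto)
    then show "edge_value p {i,j,k,l} {i,j} = u i j k + u i j l"
      using P unfolding potential_on_def by (simp add: algebra_simps char_two)
    have "edge_value p {i,j,k,l} {i,k} = edge_value p {1,i,j,k} {i,k} + edge_value p {1,i,k,l} {i,k}"
      by (rule permitted_star[OF p, of i k 1 j l]) (use ord in auto)
    then show "edge_value p {i,j,k,l} {i,k} = u i j k + u i k l"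
      using P unfolding potential_on_def by (simp add: algebra_simps char_two)
    have "edge_value p {i,j,k,l} {j,k} = edge_value p {1,i,j,k} {j,k} + edge_value p {1,j,k,l} {j,k}"
      by (rule permitted_star[OF p, of j k 1 i l]) (use ord in auto)
    then show "edge_value p {i,j,k,l} {j,k} = u i j k + u j k l"
      using P unfolding potential_on_def by (simp add: algebra_simps char_two)
  qed (use that in auto)
  have "potential_on p u i j k l" if ord: "1 \<le> i" "i < j" "j < k" "k < l" "l \<le> 6" for i j k l
  proof -
    consider "i = 1" "j = 2" | "i = 1" "2 < j" | "1 < i" using ord by linarith
    then show ?thesis using ord by cases (auto intro: tet12 tet1 tet)
  qed
  then show thesis by (rule that)
qed

lemma permitted_lift:
  assumes "p \<in> permitted w {1..6}"
  obtains z where "cocycle z"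
    "\<And>i j k l. 1 \<le> i \<Longrightarrow> i < j \<Longrightarrow> j < k \<Longrightarrow> k < l \<Longrightarrow> l \<le> 6 \<Longrightarrow> p {i,j,k,l} = tet_color z i j k l"
proof -
  obtain u where u: "\<And>i j k l. 1 \<le> i \<Longrightarrow> i < j \<Longrightarrow> j < k \<Longrightarrow> k < l \<Longrightarrow> l \<le> 6 \<Longrightarrow> potential_on p u i j k l"
    using permitted_has_potential[OF assms] by blast
  show thesis
  proof (rule that)
    show "cocycle (\<lambda>i j k. w i j k * u i j k)"
      unfolding cocycle_def by (intro allI impI potential_on_cocycle) (auto intro: u)
    show "p {i,j,k,l} = tet_color (\<lambda>i j k. w i j k * u i j k) i j k l"
      if "1 \<le> i" "i < j" "j < k" "k < l" "l \<le> 6" for i j k l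
      using that by (intro potential_on_color u)
  qed
qed

text \<open>
  Being 0 off the tetrahedra of \<open>s\<close> is the normalization of colorings of \<open>s\<close>.
\<close>

definition cochain_color :: "(nat \<Rightarrow> nat \<Rightarrow> nat \<Rightarrow> 'a) \<Rightarrow> nat set \<Rightarrow> 'a coloring" where
  "cochain_color z s t = (if t \<in> faces 3 s then
     (case sorted_list_of_set t of [i,j,k,l] \<Rightarrow> tet_color z i j k l | _ \<Rightarrow> 0) else 0)"

lemma cochain_color_eq:
  assumes "{i,j,k,l} \<subseteq> s" "i < j" "j < k" "k < l"
  shows "cochain_color z s {i,j,k,l} = tet_color z i j k l"
  using assms by (simp add: cochain_color_def sorted4 faces_def)

lemma restr_cochain_color: "t \<subseteq> s \<Longrightarrow> restr t (cochain_color z s) = cochain_color z t"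
  by (auto simp: restr_def cochain_color_def faces_def fun_eq_iff)

lemma potential_on_cochain_color:
  assumes z: "cocycle z" and ord: "1 \<le> i" "i < j" "j < k" "k < l" "l \<le> 6" and sub: "{i,j,k,l} \<subseteq> s"
  shows "potential_on (cochain_color z s) (\<lambda>a b c. z a b c / w a b c) i j k l"
proof -
  define a b c d where "a = z i j k / w i j k" and "b = z i j l / w i j l"
    and "c = z i k l / w i k l" and "d = z j k l / w j k l"
  define \<kappa> where "\<kappa> = w i j k + w i j l"
  have wz: "w j k l = w i j k + w i j l + w i k l"
    using cocycle_w ord unfolding cocycle_def by simp
  have "w i j k \<noteq> 0" "w i j l \<noteq> 0" "w i k l \<noteq> 0" "w j k l \<noteq> 0"
    using w_nonzero ord by auto
  then have sum: "w j k l * d = w i j k * a + w i j l * b + w i k l * c"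
    using z ord unfolding a_def b_def c_def d_def cocycle_def by simp
  have \<kappa>: "\<kappa> \<noteq> 0"
    using kappa_nonzero ord unfolding \<kappa>_def by blast
  have col: "cochain_color z s {i,j,k,l} = ((a + b) / \<kappa>, (c + d) / \<kappa>)"
    unfolding cochain_color_eq[OF sub ord(2-4)] tet_color_def a_def b_def c_def d_def \<kappa>_def ..
  have k1: "w j k l + w i k l = \<kappa>"
    unfolding \<kappa>_def wz by (simp add: char_two algebra_simps)
  have k2: "w i j l * (a + b) + w j k l * (c + d) = \<kappa> * (a + c)"
    unfolding distrib_left sum unfolding \<kappa>_def wz by (simp add: char_two algebra_simps)
  have "w i j l * (a + b) + w i k l * (c + d) + \<kappa> * d = w i j l * (a + b) + w i k l * c + w j k l * d"
    unfolding \<kappa>_def wz by (simp add: char_two algebra_simps)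
  also have "\<dots> = \<kappa> * a"
    unfolding sum unfolding \<kappa>_def wz by (simp add: char_two algebra_simps)
  finally have k3: "w i j l * (a + b) + w i k l * (c + d) = \<kappa> * (a + d)"
    by (metis add.commute distrib_left two')
  show ?thesis
  proof (rule potential_onI[OF ord])
    show "edge_value (cochain_color z s) {i,j,k,l} {i,j} = z i j k / w i j k + z i j l / w i j l"
      unfolding edge_value_simps[OF ord(2-4)] col k1 a_def[symmetric] b_def[symmetric]
      using \<kappa> by simp
    show "edge_value (cochain_color z s) {i,j,k,l} {i,k} = z i j k / w i j k + z i k l / w i k l"
      unfolding edge_value_simps[OF ord(2-4)] col a_def[symmetric] c_def[symmetric]
      unfolding fst_conv snd_conv times_divide_eq_right add_divide_distrib[symmetric] k2
      using \<kappa> by simp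
    show "edge_value (cochain_color z s) {i,j,k,l} {j,k} = z i j k / w i j k + z j k l / w j k l"
      unfolding edge_value_simps[OF ord(2-4)] col a_def[symmetric] d_def[symmetric]
      unfolding fst_conv snd_conv times_divide_eq_right add_divide_distrib[symmetric] k3
      using \<kappa> by simp
  qed
qed

lemma ordered_pentachoron:
  assumes "finite (s :: nat set)" "card s = 5"
  obtains i j k l m where "i < j" "j < k" "k < l" "l < m" "s = {i,j,k,l,m}"
proof -
  define xs where "xs = sorted_list_of_set s"
  have "length xs = Suc (Suc (Suc (Suc (Suc 0))))"
    using assms by (simp add: xs_def)
  then obtain i j k l m where "sorted_list_of_set s = [i,j,k,l,m]"
    by (auto simp: length_Suc_conv xs_def[symmetric])
  moreover have "sorted_wrt (<) (sorted_list_of_set s)" "set (sorted_list_of_set s) = s"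
    using assms by auto
  ultimately show thesis by (intro that[of i j k l m]) auto
qed

text \<open>
  Around an edge of a pentachoron there are three triangles, and each occurs in two of the three
  tetrahedra at the edge, so the differences of the potential add up to 0.
\<close>

lemma cochain_color_permitted:
  assumes z: "cocycle z" and s: "s \<subseteq> {1..6}"
  shows "cochain_color z s \<in> permitted w s"
proof -
  have "edge_functional w u e (restr u (cochain_color z s)) = 0"
    if u: "u \<in> faces 4 s" and e: "e \<in> faces 1 u" for u e
  proof -
    have fin: "finite u" "card u = 5" "u \<subseteq> s" using u s
      by (auto simp: faces_def intro: finite_subset)
    obtain i j k l m where ord: "i < j" "j < k" "k < l" "l < m" and u_eq: "u = {i,j,k,l,m}"
      using ordered_pentachoron[OF fin(1,2)] .
    have sub: "{i,j,k,l,m} \<subseteq> s" "1 \<le> i" "m \<le> 6" using fin(3) s u_eq by auto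
    define p where "p = cochain_color z s"
    have P: "potential_on p (\<lambda>a b c. z a b c / w a b c) i j k l"
       "potential_on p (\<lambda>a b c. z a b c / w a b c) i j k m"
       "potential_on p (\<lambda>a b c. z a b c / w a b c) i j l m"
       "potential_on p (\<lambda>a b c. z a b c / w a b c) i k l m"
       "potential_on p (\<lambda>a b c. z a b c / w a b c) j k l m"
      unfolding p_def using ord sub by (auto intro!: potential_on_cochain_color[OF z])
    have "card e = 2" "e \<subseteq> {i,j,k,l,m}" using e u_eq by (auto simp: faces_def)
    then have "e = {i,j} \<or> e = {i,k} \<or> e = {i,l} \<or> e = {i,m} \<or> e = {j,k} \<or> e = {j,l}
       \<or> e = {j,m} \<or> e = {k,l} \<or> e = {k,m} \<or> e = {l,m}"
      unfolding card_2_iff by (elim exE conjE) (auto simp: doubleton_eq_iff)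
    then show ?thesis
      using P ord fin(2)
      unfolding potential_on_def p_def[symmetric] u_eq
      by (elim disjE) (simp_all add: edge_functional_restr insert_Diff_if algebra_simps char_two)
  qed
  then show ?thesis
    unfolding permitted_def colorings_def by (auto simp: cochain_color_def)
qed

end

section \<open>The cocycle condition\<close>

lemma zeta_form_bilinear:
  "zeta_form w i j k l m p q = zeta_form w i j k l m q p"
  "zeta_form w i j k l m (p + p') q = zeta_form w i j k l m p q + zeta_form w i j k l m p' q"
  "zeta_form w i j k l m (scale_col c p) q = c * zeta_form w i j k l m p q"
proof -
  \<comment> \<open>Hiding the coefficients keeps the simplifier from expanding them.\<close>
  obtain c\<^sub>1 c\<^sub>2 c\<^sub>3 c\<^sub>4 c\<^sub>5 c\<^sub>6 c\<^sub>7 c\<^sub>8 c\<^sub>9 where z: "\<And>p q. zeta_form w i j k l m p q =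
      c\<^sub>1 * (fst (p {i,j,l,m}) * fst (q {i,j,k,m}) + fst (p {i,j,k,m}) * fst (q {i,j,l,m}))
    + c\<^sub>2 * (fst (p {i,k,l,m}) * fst (q {i,j,k,m}) + fst (p {i,j,k,m}) * fst (q {i,k,l,m}))
    + c\<^sub>3 * (fst (p {i,j,k,m}) * fst (q {i,j,k,m}))
    + c\<^sub>4 * (fst (p {i,k,l,m}) * fst (q {i,j,l,m}) + fst (p {i,j,l,m}) * fst (q {i,k,l,m}))
    + c\<^sub>5 * (fst (p {i,j,l,m}) * fst (q {i,j,l,m}))
    + c\<^sub>6 * (fst (p {i,k,l,m}) * fst (q {i,k,l,m}))
    + c\<^sub>7 * (fst (p {j,k,l,m}) * fst (q {j,k,l,m}))
    + c\<^sub>8 * (fst (p {j,k,l,m}) * fst (q {j,k,l,m}))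
    + c\<^sub>9 * (snd (p {j,k,l,m}) * snd (q {j,k,l,m}))"
    by (rule that) (unfold zeta_form_def Let_def, rule refl)
  show "zeta_form w i j k l m p q = zeta_form w i j k l m q p"
    "zeta_form w i j k l m (p + p') q = zeta_form w i j k l m p q + zeta_form w i j k l m p' q"
    "zeta_form w i j k l m (scale_col c p) q = c * zeta_form w i j k l m p q"
    unfolding z scale_col_def by (simp_all add: algebra_simps)
qed

lemma zeta_sym_bilinear: "sym_bilinear_cochain w 4 (zeta w)"
  unfolding sym_bilinear_cochain_def sym_bilinear_on_def zeta_def
  by (auto split: list.split simp: zeta_form_bilinear(2,3) intro: zeta_form_bilinear(1))

context generic_cocycle
begin

lemma zeta_eq_tet_forms:
  assumes ord: "1 \<le> i" "i < j" "j < k" "k < l" "l < m" "m \<le> 6"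
    and z: "cocycle z" "cocycle z'"
    and p: "\<And>a b c d. {a,b,c,d} \<subseteq> {i,j,k,l,m} \<Longrightarrow> a < b \<Longrightarrow> b < c \<Longrightarrow> c < d \<Longrightarrow> p {a,b,c,d} = tet_color z a b c d"
    and q: "\<And>a b c d. {a,b,c,d} \<subseteq> {i,j,k,l,m} \<Longrightarrow> a < b \<Longrightarrow> b < c \<Longrightarrow> c < d \<Longrightarrow> q {a,b,c,d} = tet_color z' a b c d"
  shows "zeta w {i,j,k,l,m} p q =
    tet_form z z' i j k l + tet_form z z' i j k m + tet_form z z' i j l m
    + tet_form z z' i k l m + tet_form z z' j k l m"
proof -
  have "zeta w {i,j,k,l,m} p q = zeta_form w i j k l m p q"
    using ord by (simp add: zeta_def sorted5)
  also have "\<dots> = tet_form z z' i j k l + tet_form z z' i j k m + tet_form z z' i j l m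
    + tet_form z z' i k l m + tet_form z z' j k l m"
    by (rule zeta_form_decomposition[OF ord z]) (use ord in \<open>auto intro!: p q\<close>)
  finally show ?thesis .
qed

text \<open>
  In the sum over the six pentachora every \<open>tet_form\<close> occurs twice.
\<close>

lemma zeta_cocycle: "cochain_eq w 5 (coboundary (zeta w)) (\<lambda>s p q. 0)"
  unfolding cochain_eq_def
proof (intro ballI)
  fix s p q
  assume s: "s \<in> simplices 5" and p: "p \<in> permitted w s" and q: "q \<in> permitted w s"
  have s_eq: "s = {1..6}"
    using s unfolding simplices_def by (intro card_subset_eq) auto
  obtain z where z: "cocycle z"
    "\<And>i j k l. 1 \<le> i \<Longrightarrow> i < j \<Longrightarrow> j < k \<Longrightarrow> k < l \<Longrightarrow> l \<le> 6 \<Longrightarrow> p {i,j,k,l} = tet_color z i j k l"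
    using permitted_lift[OF p[unfolded s_eq]] by blast
  obtain z' where z': "cocycle z'"
    "\<And>i j k l. 1 \<le> i \<Longrightarrow> i < j \<Longrightarrow> j < k \<Longrightarrow> k < l \<Longrightarrow> l \<le> 6 \<Longrightarrow> q {i,j,k,l} = tet_color z' i j k l"
    using permitted_lift[OF q[unfolded s_eq]] by blast
  have pent: "zeta w {i,j,k,l,m} (restr {i,j,k,l,m} p) (restr {i,j,k,l,m} q) =
      tet_form z z' i j k l + tet_form z z' i j k m + tet_form z z' i j l m
      + tet_form z z' i k l m + tet_form z z' j k l m"
    if ord: "1 \<le> i" "i < j" "j < k" "k < l" "l < m" "m \<le> 6" for i j k l m
  proof (rule zeta_eq_tet_forms[OF ord z(1) z'(1)])
    fix a b c d
    assume sub: "{a,b,c,d} \<subseteq> {i,j,k,l,m}" and abcd: "a < b" "b < c" "c < d"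
    have "a \<in> {i,j,k,l,m}" "d \<in> {i,j,k,l,m}" using sub by simp_all
    then have "1 \<le> a" "d \<le> 6" using ord by auto
    moreover have "{a,b,c,d} \<in> faces 3 {i,j,k,l,m}"
      using sub abcd by (simp add: faces_def)
    ultimately show "restr {i,j,k,l,m} p {a,b,c,d} = tet_color z a b c d"
      "restr {i,j,k,l,m} q {a,b,c,d} = tet_color z' a b c d"
      using abcd by (simp_all add: restr_def z z')
  qed
  have "{1..6} = {1,2,3,4,5,6::nat}" by auto
  moreover have "{1,2,3,4,5,6} - {1} = {2,3,4,5,6::nat}" "{1,2,3,4,5,6} - {2} = {1,3,4,5,6::nat}"
    "{1,2,3,4,5,6} - {3} = {1,2,4,5,6::nat}" "{1,2,3,4,5,6} - {4} = {1,2,3,5,6::nat}"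
    "{1,2,3,4,5,6} - {5} = {1,2,3,4,6::nat}" "{1,2,3,4,5,6} - {6} = {1,2,3,4,5::nat}"
    by auto
  ultimately show "coboundary (zeta w) s p q = 0"
    unfolding s_eq coboundary_def by (simp add: pent algebra_simps char_two del: One_nat_def)
qed

section \<open>Nontriviality\<close>

lemma cochain_color_cong:
  assumes "\<And>i j k. {i,j,k} \<subseteq> s \<Longrightarrow> i < j \<Longrightarrow> j < k \<Longrightarrow> z i j k = z' i j k"
  shows "cochain_color z s = cochain_color z' s"
proof
  fix t
  show "cochain_color z s t = cochain_color z' s t"
  proof (cases "\<exists>i j k l. sorted_list_of_set t = [i,j,k,l] \<and> t \<in> faces 3 s")
    case True
    then obtain i j k l where t: "sorted_list_of_set t = [i,j,k,l]" "t \<in> faces 3 s" by blast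
    then have "finite t" "t \<subseteq> s" by (auto simp: faces_def intro: card_ge_0_finite)
    moreover have "sorted_wrt (<) (sorted_list_of_set t)" by simp
    ultimately have "i < j" "j < k" "k < l" "{i,j,k,l} \<subseteq> s"
      using set_sorted_list_of_set[of t] unfolding t by auto
    then show ?thesis using t assms by (simp add: cochain_color_def tet_color_def)
  qed (auto simp: cochain_color_def split: list.split)
qed

lemma cochain_color_add:
  "cochain_color (\<lambda>i j k. z i j k + z' i j k) s = cochain_color z s + cochain_color z' s"
  by (rule ext)
    (auto simp: cochain_color_def tet_color_def add_divide_distrib ac_simps split: list.split)

lemma cochain_color_zero: "cochain_color (\<lambda>i j k. 0) s = 0"
  by (rule ext) (auto simp: cochain_color_def tet_color_def zero_prod_def split: list.split)

text \<open>
  The coboundary of the 1-cochain that is 1 on the edge \<open>ab\<close> and 0 elsewhere.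
\<close>

definition edge_cocycle :: "nat \<Rightarrow> nat \<Rightarrow> nat \<Rightarrow> nat \<Rightarrow> nat \<Rightarrow> 'a" where
  "edge_cocycle a b i j k = (if {a,b} \<subseteq> {i,j,k} then 1 else 0)"

lemma cocycle_edge: "a \<noteq> b \<Longrightarrow> cocycle (edge_cocycle a b)"
  unfolding cocycle_def edge_cocycle_def by (auto simp: char_two)

text \<open>
  Suppose \<open>\<zeta> = \<delta>c\<close> and evaluate both sides on the Pfaffian tensor. On a tetrahedron
  \<open>12345 - {v}\<close> with \<open>v \<noteq> 1\<close>, each of the three products has a factor whose edge contains \<open>v\<close> and
  which restricts to 0. On 2345 the edge cocycles at a vertex add up to 0, so
  \<open>e\<^sub>2\<^sub>5 = P + Q\<close>, \<open>e\<^sub>3\<^sub>5 = P + N\<close>, \<open>e\<^sub>4\<^sub>5 = Q + N\<close> with \<open>P = e\<^sub>2\<^sub>3\<close>, \<open>Q = e\<^sub>2\<^sub>4\<close>, \<open>N = e\<^sub>3\<^sub>4\<close>, and the three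
  terms cancel because the form is symmetric. The failure of symmetry of \<open>tet_form\<close> on 2345 is
  what makes the value of \<open>\<zeta>\<close> equal to 1.
\<close>

lemma zeta_nontrivial:
  "\<not> (\<exists>c. sym_bilinear_cochain w 3 c \<and> cochain_eq w 4 (zeta w) (coboundary c))"
proof
  assume "\<exists>c. sym_bilinear_cochain w 3 c \<and> cochain_eq w 4 (zeta w) (coboundary c)"
  then obtain c where c: "sym_bilinear_cochain w 3 c" "cochain_eq w 4 (zeta w) (coboundary c)"
    by blast
  define s :: "nat set" where "s = {1,2,3,4,5}"
  define e where "e a b t = cochain_color (edge_cocycle a b) t" for a b t
  have s: "s \<in> simplices 4" "s \<subseteq> {1..6}" "card s = 5" by (auto simp: s_def simplices_def)
  have e: "e a b t \<in> permitted w t" if "a \<noteq> b" "t \<subseteq> s" for a b t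
    unfolding e_def using that s(2) by (intro cochain_color_permitted cocycle_edge) auto
  have zeta_e: "zeta w s (e a b s) (e a' b' s) =
      (\<Sum>v\<in>s. c (s - {v}) (e a b (s - {v})) (e a' b' (s - {v})))" if "a \<noteq> b" "a' \<noteq> b'" for a b a' b'
  proof -
    have "zeta w s (e a b s) (e a' b' s) = coboundary c s (e a b s) (e a' b' s)"
      using c(2) s(1) e that unfolding cochain_eq_def by blast
    then show ?thesis
      unfolding coboundary_def e_def by (simp add: restr_cochain_color)
  qed
  have c_bil: "sym_bilinear_on (permitted w t) (c t)" if "t \<subseteq> s" "card t = 4" for t
    using c(1) that s unfolding sym_bilinear_cochain_def simplices_def by auto
  have e_zero: "e a b t = 0" if "a \<notin> t \<or> b \<notin> t" for a b t
    unfolding e_def cochain_color_zero[of t, symmetric]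
    using that by (intro cochain_color_cong) (auto simp: edge_cocycle_def)
  have c_zero: "c t 0 p = 0" "c t p 0 = 0" if t: "t \<subseteq> s" "card t = 4" and p: "p \<in> permitted w t" for t p
  proof -
    have "scale_col 0 p = 0" by (auto simp: scale_col_def fun_eq_iff zero_prod_def)
    moreover have "(0 :: 'a coloring) \<in> permitted w t"
      using cochain_color_permitted[of "\<lambda>i j k. 0" t] cochain_color_zero[of t] t s
      by (auto simp: cocycle_def)
    ultimately show "c t 0 p = 0" "c t p 0 = 0"
      using c_bil[OF t] p unfolding sym_bilinear_on_def by (metis mult_zero_left)+
  qed
  let ?S = "\<lambda>v. c (s - {v}) (e 2 3 (s - {v})) (e 4 5 (s - {v}))
     + c (s - {v}) (e 2 4 (s - {v})) (e 3 5 (s - {v})) + c (s - {v}) (e 2 5 (s - {v})) (e 3 4 (s - {v}))"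
  have "?S v = 0" if v: "v \<in> s" for v
  proof (cases "v = 1")
    case False
    have t: "s - {v} \<subseteq> s" "card (s - {v}) = 4" using v s by auto
    have "v \<in> {2,3} \<or> v \<in> {4,5}" "v \<in> {2,4} \<or> v \<in> {3,5}" "v \<in> {2,5} \<or> v \<in> {3,4}"
      using v False by (auto simp: s_def)
    then have "e 2 3 (s - {v}) = 0 \<or> e 4 5 (s - {v}) = 0" "e 2 4 (s - {v}) = 0 \<or> e 3 5 (s - {v}) = 0"
      "e 2 5 (s - {v}) = 0 \<or> e 3 4 (s - {v}) = 0"
      using e_zero by (metis Diff_iff insert_iff singletonD)+
    then show ?thesis
      by (elim disjE) (simp_all add: c_zero[OF t] e[OF _ t(1)])
  next
    case True
    define t where "t = s - {v}"
    have t: "t = {2,3,4,5}" unfolding t_def s_def True by auto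
    have t': "t \<subseteq> s" "card t = 4" unfolding t by (auto simp: s_def)
    have triangle: "(i, j, k) \<in> {(2,3,4), (2,3,5), (2,4,5), (3,4,5)}"
      if "{i,j,k} \<subseteq> t" "i < j" "j < k" for i j k
    proof -
      have "i \<in> {2,3,4,5}" "j \<in> {2,3,4,5}" "k \<in> {2,3,4,5}" using that(1) unfolding t by simp_all
      then show ?thesis using that(2,3)
        by (elim insertE emptyE; hypsubst; simp)
    qed
    define P Q N where "P = e 2 3 t" and "Q = e 2 4 t" and "N = e 3 4 t"
    have sums: "e 2 5 t = P + Q" "e 3 5 t = P + N" "e 4 5 t = Q + N"
      unfolding P_def Q_def N_def e_def cochain_color_add[symmetric]
      by (intro cochain_color_cong, drule (2) triangle, auto simp: edge_cocycle_def char_two)+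
    have "e a b t \<in> permitted w t" if "a \<noteq> b" for a b
      using e that t' by blast
    from this[of 2 3] this[of 2 4] this[of 3 4] this[of 2 5] this[of 3 5] this[of 4 5]
    have perm: "P \<in> permitted w t" "Q \<in> permitted w t" "N \<in> permitted w t"
      "P + Q \<in> permitted w t" "P + N \<in> permitted w t" "Q + N \<in> permitted w t"
      unfolding sums P_def[symmetric] Q_def[symmetric] N_def[symmetric] by simp_all
    have add: "c t (p + q) r = c t p r + c t q r" and sym: "c t p q = c t q p"
      if "p \<in> permitted w t" "q \<in> permitted w t" "r \<in> permitted w t" for p q r
      using c_bil[OF t'] that unfolding sym_bilinear_on_def by blast+
    have "c t P (Q + N) + c t Q (P + N) + c t (P + Q) N
        = (c t Q P + c t N P) + (c t P Q + c t N Q) + (c t P N + c t Q N)"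
      using perm by (simp add: sym[of P "Q + N" P] sym[of Q "P + N" P] add)
    also have "\<dots> = 0"
      using perm by (simp add: sym[of Q P P] sym[of N P P] sym[of N Q P] algebra_simps char_two)
    finally have "?S v = 0"
      unfolding t_def[symmetric] sums P_def[symmetric] Q_def[symmetric] N_def[symmetric] .
    then show ?thesis .
  qed
  then have "(\<Sum>v\<in>s. ?S v) = 0" by simp
  then have "zeta w s (e 2 3 s) (e 4 5 s) + zeta w s (e 2 4 s) (e 3 5 s) + zeta w s (e 2 5 s) (e 3 4 s) = 0"
    by (simp add: zeta_e sum.distrib)
  moreover have "zeta w s (e a b s) (e a' b' s) =
      tet_form (edge_cocycle a b) (edge_cocycle a' b') 1 2 3 4 + tet_form (edge_cocycle a b) (edge_cocycle a' b') 1 2 3 5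
    + tet_form (edge_cocycle a b) (edge_cocycle a' b') 1 2 4 5 + tet_form (edge_cocycle a b) (edge_cocycle a' b') 1 3 4 5
    + tet_form (edge_cocycle a b) (edge_cocycle a' b') 2 3 4 5" if "a \<noteq> b" "a' \<noteq> b'" for a b a' b'
    unfolding s_def e_def using that
    by (intro zeta_eq_tet_forms cocycle_edge cochain_color_eq) auto
  moreover have "w 2 3 4 + w 2 3 5 \<noteq> 0" by (rule kappa_nonzero) auto
  ultimately show False
    by (simp add: tet_form_def edge_cocycle_def polar_def char_two)
qed

end

section \<open>Generic points\<close>

definition monomial_value :: "((nat \<times> nat) \<Rightarrow>\<^sub>0 nat) \<Rightarrow> (nat \<Rightarrow> nat \<Rightarrow> 'a::field) \<Rightarrow> 'a" where
  "monomial_value m b = (\<Prod>(i, j)\<in>Poly_Mapping.keys m. b i j ^ Poly_Mapping.lookup m (i, j))"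

lemma monomial_value_superset:
  assumes "finite S" "Poly_Mapping.keys m \<subseteq> S"
  shows "monomial_value m b = (\<Prod>(i, j)\<in>S. b i j ^ Poly_Mapping.lookup m (i, j))"
  unfolding monomial_value_def
  by (rule prod.mono_neutral_left) (use assms in \<open>auto simp: in_keys_iff\<close>)

lemma monomial_value_add: "monomial_value (m + n) b = monomial_value m b * monomial_value n b"
proof -
  let ?S = "Poly_Mapping.keys m \<union> Poly_Mapping.keys n"
  have "monomial_value (m + n) b = (\<Prod>(i, j)\<in>?S. b i j ^ Poly_Mapping.lookup (m + n) (i, j))"
    by (rule monomial_value_superset) (use keys_add[of m n] in auto)
  also have "\<dots> = (\<Prod>(i, j)\<in>?S. b i j ^ Poly_Mapping.lookup m (i, j)) *
      (\<Prod>(i, j)\<in>?S. b i j ^ Poly_Mapping.lookup n (i, j))"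
    by (simp add: lookup_add power_add prod.distrib case_prod_unfold)
  also have "\<dots> = monomial_value m b * monomial_value n b"
    by (simp add: monomial_value_superset[of ?S])
  finally show ?thesis .
qed

lemma eval_edge_poly_superset:
  assumes "finite S" "Poly_Mapping.keys P \<subseteq> S"
  shows "eval_edge_poly P b = (\<Sum>m\<in>S. Poly_Mapping.lookup P m * monomial_value m b)"
  unfolding eval_edge_poly_def monomial_value_def[symmetric]
  by (rule sum.mono_neutral_left) (use assms in \<open>auto simp: in_keys_iff\<close>)

lemma eval_edge_poly_add: "eval_edge_poly (P + Q) b = eval_edge_poly P b + eval_edge_poly Q b"
proof -
  let ?S = "Poly_Mapping.keys P \<union> Poly_Mapping.keys Q"
  have "eval_edge_poly (P + Q) b = (\<Sum>m\<in>?S. Poly_Mapping.lookup (P + Q) m * monomial_value m b)"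
    by (rule eval_edge_poly_superset) (use keys_add[of P Q] in auto)
  then show ?thesis
    by (simp add: eval_edge_poly_superset[of ?S] lookup_add distrib_right sum.distrib)
qed

lemma eval_edge_poly_sum: "eval_edge_poly (\<Sum>x\<in>A. P x) b = (\<Sum>x\<in>A. eval_edge_poly (P x) b)"
  by (induction A rule: infinite_finite_induct)
    (simp_all add: eval_edge_poly_add, simp_all add: eval_edge_poly_def)

lemma eval_edge_poly_single: "eval_edge_poly (Poly_Mapping.single m c) b = c * monomial_value m b"
  by (subst eval_edge_poly_superset[of "{m}"]) simp_all

lemma sum_of_monomials: "P = (\<Sum>m\<in>Poly_Mapping.keys P. Poly_Mapping.single m (Poly_Mapping.lookup P m))"
  by (rule poly_mapping_eqI)
    (auto simp: lookup_sum lookup_single when_def in_keys_iff sum.delta)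

lemma eval_edge_poly_mult:
  "eval_edge_poly (P * Q) b = eval_edge_poly P b * eval_edge_poly Q b"
proof -
  let ?P = "Poly_Mapping.lookup P" and ?Q = "Poly_Mapping.lookup Q"
  have "P * Q = (\<Sum>m\<in>Poly_Mapping.keys P. \<Sum>n\<in>Poly_Mapping.keys Q. Poly_Mapping.single (m + n) (?P m * ?Q n))"
    unfolding mult_single[symmetric] sum_product[symmetric]
    by (rule arg_cong2[where f = "(*)"]; rule sum_of_monomials)
  then have "eval_edge_poly (P * Q) b
      = (\<Sum>m\<in>Poly_Mapping.keys P. \<Sum>n\<in>Poly_Mapping.keys Q. (?P m * monomial_value m b) * (?Q n * monomial_value n b))"
    by (simp add: eval_edge_poly_sum eval_edge_poly_single monomial_value_add ac_simps)
  then show ?thesis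
    by (simp only: eval_edge_poly_def monomial_value_def sum_product)
qed

text \<open>
  Membership is closed under sums and products, so the genericity conditions need not be
  written out as polynomials.
\<close>

definition poly_functions :: "((nat \<Rightarrow> nat \<Rightarrow> 'a::field) \<Rightarrow> 'a) set" where
  "poly_functions = {f. \<exists>P \<in> edge_polys. \<forall>b. eval_edge_poly P b = f b}"

lemma edge_polys_add: "P \<in> edge_polys \<Longrightarrow> Q \<in> edge_polys \<Longrightarrow> P + Q \<in> edge_polys"
  using keys_add[of P Q] unfolding edge_polys_def by blast

lemma edge_polys_mult:
  assumes P: "P \<in> edge_polys" and Q: "Q \<in> edge_polys"
  shows "P * Q \<in> edge_polys"
  unfolding edge_polys_def
proof (intro CollectI ballI)
  fix m assume "m \<in> Poly_Mapping.keys (P * Q)"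
  then obtain m1 m2 where m: "m = m1 + m2" "m1 \<in> Poly_Mapping.keys P" "m2 \<in> Poly_Mapping.keys Q"
    using keys_mult[of P Q] by blast
  then have "Poly_Mapping.keys m \<subseteq> Poly_Mapping.keys m1 \<union> Poly_Mapping.keys m2"
    using keys_add[of m1 m2] by simp
  then show "Poly_Mapping.keys m \<subseteq> {(i, j). 1 \<le> i \<and> i < j \<and> j \<le> 6}"
    using P Q m unfolding edge_polys_def by blast
qed

lemma poly_functions_add:
  "f \<in> poly_functions \<Longrightarrow> g \<in> poly_functions \<Longrightarrow> (\<lambda>b. f b + g b) \<in> poly_functions"
  unfolding poly_functions_def by clarsimp (metis edge_polys_add eval_edge_poly_add)

lemma poly_functions_mult:
  "f \<in> poly_functions \<Longrightarrow> g \<in> poly_functions \<Longrightarrow> (\<lambda>b. f b * g b) \<in> poly_functions"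
  unfolding poly_functions_def by clarsimp (metis edge_polys_mult eval_edge_poly_mult)

lemma poly_functions_indeterminate:
  assumes "1 \<le> i" "i < j" "j \<le> 6"
  shows "(\<lambda>b. b i j) \<in> poly_functions"
proof -
  let ?m = "Poly_Mapping.single (i, j) (1::nat)"
  have "Poly_Mapping.single ?m (1::'a) \<in> edge_polys"
    using assms by (auto simp: edge_polys_def)
  moreover have "eval_edge_poly (Poly_Mapping.single ?m 1) b = b i j" for b :: "nat \<Rightarrow> nat \<Rightarrow> 'a"
    by (simp add: eval_edge_poly_single monomial_value_def)
  ultimately show ?thesis unfolding poly_functions_def by blast
qed

text \<open>
  The polynomials form an integral domain, because their exponent vectors are linearly ordered (this
  is where the lexicographic order on pairs enters). A nonzero value anywhere shows that a single
  condition is a nonzero polynomial, and the product of the conditions is then nonzero even if it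
  vanishes at every point, as may happen over a finite field.
\<close>

lemma generic_nonvanishing:
  fixes F :: "((nat \<Rightarrow> nat \<Rightarrow> 'a::field) \<Rightarrow> 'a) set"
  assumes "finite F" "F \<subseteq> poly_functions" "\<And>f. f \<in> F \<Longrightarrow> \<exists>b. f b \<noteq> 0"
  shows "\<exists>P \<in> edge_polys. P \<noteq> 0 \<and> (\<forall>b. eval_edge_poly P b \<noteq> 0 \<longrightarrow> (\<forall>f\<in>F. f b \<noteq> 0))"
  using assms
proof (induction F)
  case empty
  have "(1 :: 'a edge_poly) \<in> edge_polys"
    by (simp add: edge_polys_def)
  then show ?case by (intro bexI[of _ 1]) auto
next
  case (insert f F)
  then obtain P where P: "P \<in> edge_polys" "P \<noteq> 0"
      "\<And>b. eval_edge_poly P b \<noteq> 0 \<Longrightarrow> \<forall>f\<in>F. f b \<noteq> 0"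
    by auto
  obtain Q where Q: "Q \<in> edge_polys" "\<And>b. eval_edge_poly Q b = f b"
    using insert.prems(1) unfolding poly_functions_def by auto
  obtain b where "eval_edge_poly Q b \<noteq> 0"
    using insert.prems(2)[of f] Q by auto
  then have "Q \<noteq> 0" by (auto simp: eval_edge_poly_def)
  then have "P * Q \<in> edge_polys" "P * Q \<noteq> 0"
    using P Q edge_polys_mult by auto
  then show ?case
    using P(3) Q(2) by (intro bexI[of _ "P * Q"]) (auto simp: eval_edge_poly_mult)
qed

lemma poly_functions_omega:
  assumes "1 \<le> i" "i < j" "j < k" "k \<le> 6"
  shows "(\<lambda>b. omega b i j k) \<in> poly_functions"
  unfolding omega_def using assms
  by (intro poly_functions_add poly_functions_indeterminate) auto

lemma cocycle_omega:
  assumes "\<And>x::'a::field. x + x = 0"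
  shows "cocycle (omega (b :: nat \<Rightarrow> nat \<Rightarrow> 'a))"
proof -
  have "x + (x + y) = y" for x y :: 'a using assms[of x] by (metis add.assoc add_0)
  moreover have "(2::'a) = 0" using assms[of 1] by simp
  ultimately show ?thesis unfolding cocycle_def omega_def by (simp add: algebra_simps)
qed

text \<open>
  Each condition is nonzero at a point with coordinates 0 and 1: one coordinate equal to 1 suffices for
  \<open>\<omega>\<^sub>i\<^sub>j\<^sub>k\<close> (namely \<open>b\<^sub>i\<^sub>j\<close>) and for \<open>\<omega>\<^sub>i\<^sub>j\<^sub>k + \<omega>\<^sub>i\<^sub>j\<^sub>l\<close> (namely \<open>b\<^sub>i\<^sub>k\<close>), two for the quadratic
  ones (namely \<open>b\<^sub>i\<^sub>l\<close> and \<open>b\<^sub>j\<^sub>m\<close>, which make one of the two products 1 and the other 0).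
\<close>

lemma generic_omega:
  assumes two: "\<And>x::'a::field. x + x = 0"
  shows "\<exists>P :: 'a edge_poly. P \<in> edge_polys \<and> P \<noteq> 0 \<and>
    (\<forall>b. eval_edge_poly P b \<noteq> 0 \<longrightarrow> generic_cocycle (omega b))"
proof -
  define W where "W = (\<lambda>(i, j, k) b. omega b i j k :: 'a) ` {(i, j, k). 1 \<le> i \<and> i < j \<and> j < k \<and> k \<le> 6}"
  define K where "K = (\<lambda>(i, j, k, l) b. omega b i j k + omega b i j l :: 'a) `
    {(i, j, k, l). 1 \<le> i \<and> i < j \<and> j < k \<and> k < l \<and> l \<le> 6}"
  define D where "D = (\<lambda>(i, j, k, l, m) b.
      omega b i k l * omega b j k m + omega b i k m * omega b j k l :: 'a) `
    {(i, j, k, l, m). 1 \<le> i \<and> i < j \<and> j < k \<and> k < l \<and> l < m \<and> m \<le> 6}"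
  have "finite W"
    unfolding W_def
    by (rule finite_imageI, rule finite_subset[of _ "{1..6} \<times> {1..6} \<times> {1..6}"]) auto
  moreover have "finite K"
    unfolding K_def
    by (rule finite_imageI, rule finite_subset[of _ "{1..6} \<times> {1..6} \<times> {1..6} \<times> {1..6}"]) auto
  moreover have "finite D"
    unfolding D_def
    by (rule finite_imageI, rule finite_subset[of _ "{1..6} \<times> {1..6} \<times> {1..6} \<times> {1..6} \<times> {1..6}"]) auto
  ultimately have fin: "finite (W \<union> K \<union> D)" by simp
  have sub: "W \<union> K \<union> D \<subseteq> poly_functions"
    unfolding W_def K_def D_def
    by (auto intro!: poly_functions_add poly_functions_mult poly_functions_omega)
  have "\<exists>b. omega b i j k \<noteq> (0::'a)" if "i < j" "j < k" for i j k
    by (rule exI[of _ "\<lambda>x y. if (x, y) = (i, j) then 1 else 0"]) (use that in \<open>simp add: omega_def\<close>)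
  then have W: "\<forall>f\<in>W. \<exists>b. f b \<noteq> 0"
    unfolding W_def by simp
  have "\<exists>b. omega b i j k + omega b i j l \<noteq> (0::'a)" if "i < j" "j < k" "k < l" for i j k l
    by (rule exI[of _ "\<lambda>x y. if (x, y) = (i, k) then 1 else 0"]) (use that in \<open>simp add: omega_def\<close>)
  then have K: "\<forall>f\<in>K. \<exists>b. f b \<noteq> 0"
    unfolding K_def by simp
  have "\<exists>b. omega b i k l * omega b j k m + omega b i k m * omega b j k l \<noteq> (0::'a)"
    if "i < j" "j < k" "k < l" "l < m" for i j k l m
    by (rule exI[of _ "\<lambda>x y. if (x, y) = (i, l) \<or> (x, y) = (j, m) then 1 else 0"])
      (use that in \<open>simp add: omega_def\<close>)
  then have D: "\<forall>f\<in>D. \<exists>b. f b \<noteq> 0"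
    unfolding D_def by simp
  have nonzero: "\<exists>b. f b \<noteq> 0" if "f \<in> W \<union> K \<union> D" for f
    using that W K D by (elim UnE) simp_all
  have "\<exists>P \<in> edge_polys. P \<noteq> 0 \<and>
      (\<forall>b. eval_edge_poly P b \<noteq> 0 \<longrightarrow> (\<forall>f \<in> W \<union> K \<union> D. f b \<noteq> 0))"
    by (rule generic_nonvanishing[OF fin sub nonzero])
  then obtain P where P: "P \<in> edge_polys" "P \<noteq> 0"
    "\<forall>b. eval_edge_poly P b \<noteq> 0 \<longrightarrow> (\<forall>f \<in> W \<union> K \<union> D. f b \<noteq> 0)"
    by (elim bexE conjE) simp
  have "generic_cocycle (omega b)" if b: "eval_edge_poly P b \<noteq> 0" for b
  proof
    fix i j k l m :: nat
    have nz: "f b \<noteq> 0" if "f \<in> W \<union> K \<union> D" for f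
      using P(3) b that by simp
    show "x + x = 0" for x :: 'a by (rule two)
    show "cocycle (omega b)" by (rule cocycle_omega[OF two])
    show "omega b i j k \<noteq> 0" if "1 \<le> i" "i < j" "j < k" "k \<le> 6"
    proof (rule nz)
      show "(\<lambda>b. omega b i j k) \<in> W \<union> K \<union> D"
        using that unfolding W_def by (intro UnI1 image_eqI[of _ _ "(i, j, k)"]) simp_all
    qed
    show "omega b i j k + omega b i j l \<noteq> 0" if "1 \<le> i" "i < j" "j < k" "k < l" "l \<le> 6"
    proof (rule nz)
      show "(\<lambda>b. omega b i j k + omega b i j l) \<in> W \<union> K \<union> D"
        using that unfolding K_def by (intro UnI1 UnI2 image_eqI[of _ _ "(i, j, k, l)"]) simp_all
    qed
    show "omega b i k l * omega b j k m + omega b i k m * omega b j k l \<noteq> 0"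
      if "1 \<le> i" "i < j" "j < k" "k < l" "l < m" "m \<le> 6"
    proof (rule nz)
      show "(\<lambda>b. omega b i k l * omega b j k m + omega b i k m * omega b j k l) \<in> W \<union> K \<union> D"
        using that unfolding D_def by (intro UnI2 image_eqI[of _ _ "(i, j, k, l, m)"]) simp_all
    qed
  qed
  with P(1,2) show ?thesis by (intro exI[of _ P]) simp
qed

section \<open>The theorem\<close>

theorem mainTheorem5:
  assumes "CHAR('a::field) = 2"
  shows "\<exists>P :: 'a edge_poly. P \<in> edge_polys \<and> P \<noteq> 0 \<and>
    (\<forall>b :: nat \<Rightarrow> nat \<Rightarrow> 'a. eval_edge_poly P b \<noteq> 0 \<longrightarrow>
       zeta_denominators_nonzero (omega b) \<and>
       sym_bilinear_cochain (omega b) 4 (zeta (omega b)) \<and>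
       cochain_eq (omega b) 5 (coboundary (zeta (omega b))) (\<lambda>s p q. 0) \<and>
       \<not> (\<exists>c. sym_bilinear_cochain (omega b) 3 c \<and>
              cochain_eq (omega b) 4 (zeta (omega b)) (coboundary c)))"
proof -
  have "(2::'a) = 0"
    using of_nat_CHAR[where ?'a = 'a] assms by simp
  then have "x + x = 0" for x :: 'a
    by (metis mult_2 mult_zero_left)
  from generic_omega[OF this] obtain P :: "'a edge_poly" where P: "P \<in> edge_polys" "P \<noteq> 0"
      "\<And>b. eval_edge_poly P b \<noteq> 0 \<Longrightarrow> generic_cocycle (omega b)"
    by blast
  show ?thesis
  proof (intro exI[of _ P] conjI allI impI P(1,2))
    fix b :: "nat \<Rightarrow> nat \<Rightarrow> 'a"
    assume "eval_edge_poly P b \<noteq> 0"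
    then interpret generic_cocycle "omega b"
      by (rule P(3))
    show "zeta_denominators_nonzero (omega b)"
      using kappa_nonzero D_nonzero
      by (simp add: zeta_denominators_nonzero_def add.commute)
    show "sym_bilinear_cochain (omega b) 4 (zeta (omega b))"
      by (rule zeta_sym_bilinear)
    show "cochain_eq (omega b) 5 (coboundary (zeta (omega b))) (\<lambda>s p q. 0)"
      by (rule zeta_cocycle)
    show "\<not> (\<exists>c. sym_bilinear_cochain (omega b) 3 c \<and>
              cochain_eq (omega b) 4 (zeta (omega b)) (coboundary c))"
      by (rule zeta_nontrivial)
  qed
qed

end
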